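(* Let $m,n\ge1$ with $\gcd(m,n)=1$, $d=m+n$, and let $A\in\operatorname{Mat}_{m\times n}(\mathbb{R})$ be such that $x_A$ has an accumulation sequence of length $d$ (i.e. $A$ is not $k$-divergent for any $0\le k\le d-2$). Then for any nonzero $p_0\in\mathbb{Z}^m$ and any $\eta\in\mathbb{R}^m$, for Lebesgue almost every $t\in\mathbb{R}$, $$\liminf_{q\in\mathbb{Z}^n,\ \|q\|\to\infty}\|q\|^{n/m}\langle Aq-(tp_0+\eta)\rangle=0 .$$
   Context: Fix norms $\|\cdot\|$ on $\mathbb{R}^m,\mathbb{R}^n$; $\langle z\rangle=\min_{p\in\mathbb{Z}^m}\|z-p\|$. $X$ is the space of unimodular lattices in $\mathbb{R}^d$ with the quotient topology from $\operatorname{SL}_d(\mathbb{R})/\operatorname{SL}_d(\mathbb{Z})$; $h_t=\operatorname{diag}(e^{nt}I_m,e^{-mt}I_n)$; $x_A=\begin{pmatrix}I_m&A\\0&I_n\end{pmatrix}\mathbb{Z}^d$. For $x\in X$, $\partial(x)$ is the set of $y\in X$ with $h_{t_k}x\to y$ for some unbounded $(t_k)\subset\mathbb{R}_{\ge0}$. An accumulation sequence of length $k+1$ for $x$ is $(x_0=x,\dots,x_k)\in X^{k+1}$ with $x_{i+1}\in\partial(x_i)$; $x$ (resp. $A$, via $x_A$) is $k$-divergent if $k$ is the supremum of (length$-1$) over its accumulation sequences. *)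

theory Defs
  imports "HOL-Analysis.Analysis"
begin

definition is_norm :: "(real^'k \<Rightarrow> real) \<Rightarrow> bool" where
  "is_norm N \<longleftrightarrow>
     (\<forall>x. 0 \<le> N x) \<and> (\<forall>x. N x = 0 \<longleftrightarrow> x = 0) \<and>
     (\<forall>c x. N (c *\<^sub>R x) = \<bar>c\<bar> * N x) \<and> (\<forall>x y. N (x + y) \<le> N x + N y)"

definition int_vectors :: "(real^'k) set" where
  "int_vectors = {z. \<forall>i. z $ i \<in> \<int>}"

text \<open>For a norm the infimum below is attained, since only finitely many integer points lie
  in a bounded region.\<close>
definition dist_to_int :: "(real^'k \<Rightarrow> real) \<Rightarrow> real^'k \<Rightarrow> real" where
  "dist_to_int N z = (INF p\<in>int_vectors. N (z - p))"

definition SL :: "(real^'k^'k) set" where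
  "SL = {g. det g = 1}"

definition lattice_of :: "real^'k^'k \<Rightarrow> (real^'k) set" where
  "lattice_of g = (\<lambda>z. g *v z) ` int_vectors"

definition unimodular_lattices :: "(real^'k) set set" where
  "unimodular_lattices = lattice_of ` SL"

text \<open>The coset of a matrix \<open>g\<close> modulo the integral special linear group is identified with the
  lattice \<open>lattice_of g\<close>; the quotient topology is transported along this bijection, so a set
  of lattices is open iff its preimage in \<open>SL\<close> is relatively open
  (see \<open>quotient_map_lattice_of\<close>).\<close>
definition lattice_topology :: "(real^'k) set topology" where
  "lattice_topology = topology (\<lambda>U. U \<subseteq> unimodular_lattices \<and>
     openin (top_of_set SL) {g \<in> SL. lattice_of g \<in> U})"

lemma openin_lattice_topology:
  fixes U :: "(real^'k) set set"
  shows "openin lattice_topology U \<longleftrightarrow>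
     U \<subseteq> unimodular_lattices \<and> openin (top_of_set SL) {g \<in> SL. lattice_of g \<in> U}"
proof -
  have "istopology (\<lambda>U. U \<subseteq> unimodular_lattices \<and>
     openin (top_of_set SL) {g \<in> SL :: (real^'k^'k) set. lattice_of g \<in> U})"
    unfolding istopology_def
  proof (intro conjI allI impI)
    fix S T :: "(real^'k) set set"
    assume "S \<subseteq> unimodular_lattices \<and> openin (top_of_set SL) {g \<in> SL. lattice_of g \<in> S}"
      and "T \<subseteq> unimodular_lattices \<and> openin (top_of_set SL) {g \<in> SL. lattice_of g \<in> T}"
    moreover have "{g \<in> SL. lattice_of g \<in> S \<inter> T} =
        {g \<in> SL. lattice_of g \<in> S} \<inter> {g \<in> SL. lattice_of g \<in> T}"
      by blast
    ultimately show "S \<inter> T \<subseteq> unimodular_lattices"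
      and "openin (top_of_set SL) {g \<in> SL. lattice_of g \<in> S \<inter> T}"
      by (auto intro: openin_Int)
  next
    fix K :: "(real^'k) set set set"
    assume K: "\<forall>S\<in>K. S \<subseteq> unimodular_lattices \<and>
      openin (top_of_set SL) {g \<in> SL. lattice_of g \<in> S}"
    then show "\<Union>K \<subseteq> unimodular_lattices"
      by blast
    have "{g \<in> SL. lattice_of g \<in> \<Union>K} = (\<Union>S\<in>K. {g \<in> SL. lattice_of g \<in> S})"
      by blast
    with K show "openin (top_of_set SL) {g \<in> SL. lattice_of g \<in> \<Union>K}"
      by auto
  qed
  then show ?thesis
    unfolding lattice_topology_def by (simp add: topology_inverse')
qed

lemma topspace_lattice_topology [simp]:
  "topspace lattice_topology = (unimodular_lattices :: (real^'k) set set)"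
proof -
  have "{g \<in> SL. lattice_of g \<in> unimodular_lattices} = (SL :: (real^'k^'k) set)"
    by (auto simp: unimodular_lattices_def)
  then have "openin lattice_topology (unimodular_lattices :: (real^'k) set set)"
    by (simp add: openin_lattice_topology)
  then show ?thesis
    by (metis openin_lattice_topology openin_subset openin_topspace subset_antisym)
qed

lemma quotient_map_lattice_of: "quotient_map (top_of_set SL) lattice_topology lattice_of"
  by (simp add: quotient_map_def openin_lattice_topology unimodular_lattices_def)

definition h_mat :: "real \<Rightarrow> real^('m::finite + 'n::finite)^('m + 'n)" where
  "h_mat t = (\<chi> i j. if i = j
     then (case i of Inl _ \<Rightarrow> exp (real CARD('n) * t) | Inr _ \<Rightarrow> exp (- real CARD('m) * t))
     else 0)"

definition u_mat :: "real^'n^'m \<Rightarrow> real^('m::finite + 'n::finite)^('m + 'n)" where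
  "u_mat A = (\<chi> i j. case (i, j) of
       (Inl a, Inr b) \<Rightarrow> A $ a $ b
     | _ \<Rightarrow> (if i = j then 1 else 0))"

definition x_lattice :: "real^'n^'m \<Rightarrow> (real^('m::finite + 'n::finite)) set" where
  "x_lattice A = lattice_of (u_mat A)"

definition boundary_set ::
    "(real^('m::finite + 'n::finite)) set \<Rightarrow> (real^('m + 'n)) set set" where
  "boundary_set x = {y \<in> unimodular_lattices.
     \<exists>t :: nat \<Rightarrow> real. (\<forall>k. 0 \<le> t k) \<and> \<not> bounded (range t) \<and>
       limitin lattice_topology (\<lambda>k. (\<lambda>v. h_mat (t k) *v v) ` x) y sequentially}"

definition accumulation_sequence ::
    "(real^('m::finite + 'n::finite)) set \<Rightarrow> (real^('m + 'n)) set list \<Rightarrow> bool" where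
  "accumulation_sequence x xs \<longleftrightarrow>
     xs \<noteq> [] \<and> xs ! 0 = x \<and> set xs \<subseteq> unimodular_lattices \<and>
     (\<forall>i. Suc i < length xs \<longrightarrow> xs ! Suc i \<in> boundary_set (xs ! i))"

end

theory Submission
  imports Defs
begin

text \<open>
  Write \<open>p\<close> for the vector with components \<open>(p0, 0)\<close>. The grid of \<open>t\<close> moves along the direction \<open>p\<close>, and
  under the flow this direction becomes \<open>z = inverse g' * h\<^sub>T p\<close> in the coordinates of a basis \<open>g'\<close> of
  \<open>h\<^sub>T x\<close>. By Weyl's criterion an orbit segment in direction \<open>z\<close> can only fail to be
  equidistributed on the torus because of integral characters \<open>\<xi>\<close> with \<open>\<xi> \<bullet> z\<close> bounded. Passing to
  an accumulation point confines these characters to a proper subspace, and every further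
  accumulation point lowers its dimension: if \<open>r\<close> independent integral characters lay in the
  transported \<open>r\<close>-dimensional subspace infinitely often, the covolume of that rational subspace
  would be preserved by the changes of basis, whereas \<open>h\<^sub>s\<close> multiplies each of its Pluecker
  coordinates by \<open>exp (s * (n * a - m * b))\<close>, with a nonzero exponent since \<open>m\<close> and \<open>n\<close> are coprime.
  After \<open>d - 1\<close> steps at most a line of bad characters is left. The orbit segment then equidistributes
  inside a hyperplane \<open>L = v\<close> of the torus, and the region
  \<open>0 < \<parallel>q\<parallel>, \<parallel>q\<parallel> powr (n / m) * \<parallel>p\<parallel> < \<epsilon>\<close> meets all such hyperplanes (up to the lattice) in a uniformly
  positive proportion. So the exceptional set of \<open>t\<close> has relative measure at most \<open>1 - c\<close> in every short
  interval and is negligible by Vitali's covering theorem.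
\<close>

subsection \<open>Sets of bounded density\<close>

text \<open>Vitali's theorem fills almost all of \<open>B\<close> with disjoint short balls inside
  an open \<open>T\<close> barely larger than \<open>B\<close>. Summing the density bound over them
  gives |B| \<le> c (|B| + e) for every e > 0, which with c < 1 and finite measure leaves only |B| =
  0.\<close>

lemma negligible_if_density_bounded_aux:
  fixes B :: "real set"
  assumes B: "B \<in> lmeasurable" and c: "c < 1" and h: "h > 0"
    and le: "\<And>x d. 0 < d \<Longrightarrow> d < h \<Longrightarrow>
      measure lebesgue (B \<inter> ball x d) \<le> c * measure lebesgue (ball x d)"
  shows "negligible B"
proof -
  have cpos: "c \<ge> 0"
  proof -
    have "0 \<le> measure lebesgue (B \<inter> ball 0 (h/2))" by simp
    also have "\<dots> \<le> c * measure lebesgue (ball (0::real) (h/2))"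
      using le[of "h/2" 0] h by simp
    finally have "0 \<le> c * measure lebesgue (ball (0::real) (h/2))" .
    moreover have "measure lebesgue (ball (0::real) (h/2)) > 0"
      using content_ball_pos[of "h/2" "0::real"] h by simp
    ultimately show ?thesis
      by (meson mult_neg_pos not_le)
  qed
  have "measure lebesgue B \<le> c * (measure lebesgue B + e)" if e: "e > 0" for e
  proof -
    obtain T where T: "open T" "B \<subseteq> T" "(T - B) \<in> lmeasurable" "emeasure lebesgue (T - B) < ennreal e"
      using sets_lebesgue_outer_open[of B e] B e by blast
    have Tm: "T \<in> lmeasurable"
    proof -
      have "T = B \<union> (T - B)" using T by blast
      then show ?thesis using B T(3) by (metis fmeasurable.Un)
    qed
    have Tle: "measure lebesgue T \<le> measure lebesgue B + e"
    proof -
      have "measure lebesgue T = measure lebesgue (B \<union> (T - B))" using T(2) by (simp add: Un_absorb1)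
      also have "\<dots> \<le> measure lebesgue B + measure lebesgue (T - B)"
        using B T(3) by (intro measure_Un_le) auto
      also have "measure lebesgue (T - B) \<le> e"
        using T(4) e by (simp add: measure_def enn2real_leI)
      finally show ?thesis by simp
    qed
    let ?K = "{(x, d). x \<in> B \<and> 0 < d \<and> d < h \<and> ball x d \<subseteq> T}"
    obtain C where C: "countable C" "C \<subseteq> ?K"
        "pairwise (\<lambda>i j. disjnt (ball (fst i) (snd i)) (ball (fst j) (snd j))) C"
        "negligible (B - (\<Union>i\<in>C. ball (fst i) (snd i)))"
    proof (rule Vitali_covering_theorem_balls[of B ?K fst snd])
      fix x :: real and d :: real assume x: "x \<in> B" and d: "0 < d"
      obtain r where r: "r > 0" "ball x r \<subseteq> T" using T x by (meson openE subsetD)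
      show "\<exists>i. i \<in> ?K \<and> x \<in> ball (fst i) (snd i) \<and> snd i < d"
        using r x d h
        by (intro exI[of _ "(x, min r (min h d) / 2)"]) (auto simp: subset_iff)
    qed (rule that)
    let ?b = "\<lambda>i. ball (fst i) (snd i) :: real set"
    \<comment> \<open>A bound that is uniform over finite subfamilies passes to the countable
      union.\<close>
    have fin: "measure lebesgue (\<Union>i\<in>I. B \<inter> ?b i) \<le> c * measure lebesgue T"
      if I: "I \<subseteq> C" "finite I" for I
    proof -
      have "measure lebesgue (\<Union>i\<in>I. B \<inter> ?b i) \<le> (\<Sum>i\<in>I. measure lebesgue (B \<inter> ?b i))"
        using I B by (intro measure_UNION_le) auto
      also have "\<dots> \<le> (\<Sum>i\<in>I. c * measure lebesgue (?b i))"
        using I C by (intro sum_mono le) auto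
      also have "\<dots> = c * measure lebesgue (\<Union>i\<in>I. ?b i)"
        using I pairwise_subset[OF C(3) I(1)] by (subst measure_UNION') (auto simp: sum_distrib_left)
      also have "\<dots> \<le> c * measure lebesgue T"
        proof (intro mult_left_mono measure_mono_fmeasurable)
        have "?b i \<subseteq> T" if "i \<in> I" for i
        proof -
          have "i \<in> ?K" using that I(1) C(2) by (meson subsetD)
          then show ?thesis by (simp add: case_prod_unfold)
        qed
        then show "(\<Union>i\<in>I. ?b i) \<subseteq> T" by blast
      qed (use I(2) Tm cpos in auto)
      finally show ?thesis .
    qed
    have m: "(\<Union>i\<in>C. B \<inter> ?b i) \<in> lmeasurable" "measure lebesgue (\<Union>i\<in>C. B \<inter> ?b i) \<le> c * measure lebesgue T"
    proof -
      show "(\<Union>i\<in>C. B \<inter> ?b i) \<in> lmeasurable"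
        by (rule fmeasurable_UN_bound[OF C(1) _ fin]) (use B in auto)
      show "measure lebesgue (\<Union>i\<in>C. B \<inter> ?b i) \<le> c * measure lebesgue T"
        by (rule measure_UN_bound[OF C(1) _ fin]) (use B in auto)
    qed
    have "measure lebesgue B = measure lebesgue (\<Union>i\<in>C. B \<inter> ?b i)"
      using m(1) C(4)
      by (intro measure_negligible_symdiff[OF m(1)])
         (rule negligible_subset[OF C(4)], auto)
    also have "\<dots> \<le> c * measure lebesgue T" by (rule m)
    also have "\<dots> \<le> c * (measure lebesgue B + e)" using Tle cpos by (intro mult_left_mono)
    finally show ?thesis .
  qed
  note main = this
  have "measure lebesgue B \<le> c * measure lebesgue B + e" if "e > 0" for e
  proof -
    have "measure lebesgue B \<le> c * (measure lebesgue B + e)" by (rule main[OF that])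
    also have "\<dots> \<le> c * measure lebesgue B + e"
      using that c cpos mult_right_mono[of c 1 e] by (simp add: distrib_left)
    finally show ?thesis .
  qed
  then have "measure lebesgue B \<le> c * measure lebesgue B"
    by (rule field_le_epsilon)
  then have "measure lebesgue B = 0"
    using c mult_strict_right_mono[of c 1 "measure lebesgue B"] measure_nonneg[of lebesgue B]
    by linarith
  then show ?thesis using B negligible_iff_measure0[of B] by simp
qed

text \<open>Intersecting with balls of integer radius makes the measure finite and preserves the
  density bound.\<close>

lemma negligible_if_density_bounded:
  fixes B :: "real set"
  assumes B: "B \<in> sets lebesgue" and c: "c < 1" and h: "h > 0"
    and le: "\<And>x d. 0 < d \<Longrightarrow> d < h \<Longrightarrow>
      measure lebesgue (B \<inter> ball x d) \<le> c * measure lebesgue (ball x d)"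
  shows "negligible B"
proof -
  have "negligible (B \<inter> ball 0 (real k))" for k
  proof (rule negligible_if_density_bounded_aux[OF _ c h])
    show "B \<inter> ball 0 (real k) \<in> lmeasurable"
      using B by (subst Int_commute) (intro fmeasurable_Int_fmeasurable lmeasurable_ball)
    fix x d :: real assume d: "0 < d" "d < h"
    have Bx: "B \<inter> ball x d \<in> lmeasurable"
      using B by (subst Int_commute) (intro fmeasurable_Int_fmeasurable lmeasurable_ball)
    have "B \<inter> ball x d \<inter> ball 0 (real k) \<in> lmeasurable"
      by (rule fmeasurable.Int[OF Bx lmeasurable_ball])
    then have "B \<inter> ball 0 (real k) \<inter> ball x d \<in> sets lebesgue"
      by (metis fmeasurableD inf.assoc inf.commute)
    then have "measure lebesgue (B \<inter> ball 0 (real k) \<inter> ball x d) \<le> measure lebesgue (B \<inter> ball x d)"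
      using Bx by (intro measure_mono_fmeasurable) auto
    also have "\<dots> \<le> c * measure lebesgue (ball x d)" using le[OF d] .
    finally show "measure lebesgue (B \<inter> ball 0 (real k) \<inter> ball x d) \<le> c * measure lebesgue (ball x d)" .
  qed
  then have "negligible (\<Union>k. B \<inter> ball 0 (real k))" by (rule negligible_Union_nat)
  moreover have "(\<Union>k. B \<inter> ball 0 (real k)) = B"
  proof -
    have "\<exists>k. x \<in> ball 0 (real k)" for x :: real
      using reals_Archimedean2[of "\<bar>x\<bar>"] by simp
    then show ?thesis by blast
  qed
  ultimately show ?thesis by simp
qed

subsection \<open>Orbits on the torus along short intervals\<close>

text \<open>Euler's formula and the binomial theorem: the exponents \<open>k\<close> and
  \<open>2*N - k\<close> of the two conjugate exponentials combine to the integer frequency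
  \<open>k - N\<close>.\<close>

lemma cos_even_power_expansion:
  "complex_of_real (cos (pi * x) ^ (2 * N)) =
    (\<Sum>k\<le>2*N. of_real (real ((2*N) choose k) / 4 ^ N) * cis (2 * pi * ((real k - real N) * x)))"
proof -
  have "complex_of_real (cos (pi * x)) = (cis (pi * x) + cis (- (pi * x))) / 2"
    by (simp add: complex_eq_iff)
  then have "complex_of_real (cos (pi * x) ^ (2 * N)) = (cis (pi * x) + cis (- (pi * x))) ^ (2*N) / 4 ^ N"
    by (simp only: of_real_power power_divide) (simp add: power_mult)
  also have "(cis (pi * x) + cis (- (pi * x))) ^ (2*N) =
      (\<Sum>k\<le>2*N. of_nat ((2*N) choose k) * cis (pi * x) ^ k * cis (- (pi * x)) ^ (2*N - k))"
    by (rule binomial_ring)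
  also have "\<dots> = (\<Sum>k\<le>2*N. of_nat ((2*N) choose k) * cis (2 * pi * ((real k - real N) * x)))"
  proof (rule sum.cong[OF refl])
    fix k assume "k \<in> {..2*N}"
    then have k: "real (2*N - k) = 2 * real N - real k" by (simp add: of_nat_diff)
    have "cis (pi * x) ^ k * cis (- (pi * x)) ^ (2*N - k) = cis (2 * pi * ((real k - real N) * x))"
      unfolding Complex.DeMoivre cis_mult by (rule arg_cong[where f=cis]) (simp only: k, simp add: algebra_simps)
    then show "of_nat ((2*N) choose k) * cis (pi * x) ^ k * cis (- (pi * x)) ^ (2*N - k)
        = of_nat ((2*N) choose k) * cis (2 * pi * ((real k - real N) * x))"
      by (simp add: mult.assoc)
  qed
  finally show ?thesis
    by (simp add: sum_divide_distrib)
qed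

lemma cis_sum: "finite A \<Longrightarrow> (\<Prod>i\<in>A. cis (f i)) = cis (\<Sum>i\<in>A. f i)"
  by (induction A rule: finite_induct) (auto simp: cis_mult)

text \<open>Multiplying out the one-dimensional expansions gives one integral character for each
  multi-index. The left side is real, so taking real parts leaves cosines.\<close>

lemma prod_cos_even_power_expansion:
  fixes x :: "real^'k"
  shows "(\<Prod>i\<in>UNIV. cos (pi * x $ i) ^ (2 * N)) =
    (\<Sum>\<kappa>\<in>PiE UNIV (\<lambda>_. {..2*N}). (\<Prod>i\<in>UNIV. real ((2*N) choose \<kappa> i) / 4 ^ N) *
       cos (2 * pi * ((\<chi> i. real (\<kappa> i) - real N) \<bullet> x)))"
proof -
  have "complex_of_real (\<Prod>i\<in>UNIV. cos (pi * x $ i) ^ (2 * N)) =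
    (\<Prod>i\<in>UNIV. \<Sum>k\<le>2*N. of_real (real ((2*N) choose k) / 4 ^ N) * cis (2 * pi * ((real k - real N) * x $ i)))"
    by (simp only: of_real_prod cos_even_power_expansion)
  also have "\<dots> = (\<Sum>\<kappa>\<in>PiE UNIV (\<lambda>_. {..2*N}). \<Prod>i\<in>UNIV. of_real (real ((2*N) choose \<kappa> i) / 4 ^ N) *
       cis (2 * pi * ((real (\<kappa> i) - real N) * x $ i)))"
    by (rule prod_sum_PiE) auto
  also have "\<dots> = (\<Sum>\<kappa>\<in>PiE UNIV (\<lambda>_. {..2*N}). of_real (\<Prod>i\<in>UNIV. real ((2*N) choose \<kappa> i) / 4 ^ N) *
       cis (2 * pi * ((\<chi> i. real (\<kappa> i) - real N) \<bullet> x)))"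
    by (simp only: prod.distrib cis_sum finite of_real_prod inner_vec_def sum_distrib_left
        vec_lambda_beta inner_real_def mult.assoc)
  finally have "Re (complex_of_real (\<Prod>i\<in>UNIV. cos (pi * x $ i) ^ (2 * N))) = Re (\<Sum>\<kappa>\<in>PiE UNIV (\<lambda>_. {..2*N}). of_real (\<Prod>i\<in>UNIV. real ((2*N) choose \<kappa> i) / 4 ^ N) *
       cis (2 * pi * ((\<chi> i. real (\<kappa> i) - real N) \<bullet> x)))"
    by simp
  then show ?thesis by (simp only: Re_complex_of_real Re_sum) (simp only: times_complex.sel Re_complex_of_real Im_complex_of_real cis.sel mult_zero_left diff_zero)
qed

text \<open>Subtracting the nearest integer preserves the squared cosine and leaves an argument of
  absolute value in (\<delta>, 1/2], a range on which the cosine of \<open>pi\<close> times it is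
  nonnegative and decreasing.\<close>

lemma cos_sq_le_off_integers:
  assumes "0 < \<delta>" "\<delta> < 1/2" and far: "\<And>n::int. \<bar>x + of_int n\<bar> > \<delta>"
  shows "cos (pi * x) ^ 2 \<le> cos (pi * \<delta>) ^ 2"
proof -
  define u where "u = x - of_int (round x)"
  have u: "\<bar>u\<bar> \<le> 1/2" using of_int_round_abs_le[of x] by (simp add: u_def abs_minus_commute)
  have u2: "\<bar>u\<bar> > \<delta>" using far[of "- round x"] by (simp add: u_def)
  have "cos (2 * (pi * x)) = cos (2 * (pi * u))"
  proof -
    have "2 * (pi * x) = 2 * (pi * u) + 2 * pi * of_int (round x)" by (simp add: u_def algebra_simps)
    moreover have "cos (2 * (pi * u) + of_int (round x) * (2 * pi)) = cos (2 * (pi * u))"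
      using cos.plus_of_int[of "2 * (pi * u)" "round x"] by simp
    ultimately show ?thesis by (simp add: mult.commute)
  qed
  then have "cos (pi * x) ^ 2 = cos (pi * u) ^ 2"
    unfolding cos_double_cos by simp
  also have "cos (pi * u) = cos (pi * \<bar>u\<bar>)"
    by (cases "u \<ge> 0") auto
  also have "cos (pi * \<bar>u\<bar>) ^ 2 \<le> cos (pi * \<delta>) ^ 2"
  proof (rule power_mono)
    show "cos (pi * \<bar>u\<bar>) \<le> cos (pi * \<delta>)"
      using u u2 assms by (intro cos_monotone_0_pi_le) (auto intro: order_trans[of _ "pi * (1/2)"])
    show "0 \<le> cos (pi * \<bar>u\<bar>)"
      using u by (intro cos_ge_zero) (auto intro: order_trans[of _ 0] order_trans[of _ "pi * (1/2)"])
  qed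
  finally show ?thesis .
qed

text \<open>The polynomial is the product of the \<open>cos (pi * x\<^sub>i) ^ (2 * N)\<close>: away from the integer points it decays
  exponentially in \<open>N\<close>, while its mean, the central binomial coefficient, decays only polynomially.\<close>

lemma trig_minorant:
  fixes \<delta> :: real
  assumes \<delta>: "0 < \<delta>" "\<delta> < 1/2"
  obtains K :: "('k::finite \<Rightarrow> nat) set" and \<Xi> :: "('k \<Rightarrow> nat) \<Rightarrow> real^'k" and C :: "('k \<Rightarrow> nat) \<Rightarrow> real" and \<kappa>0
  where "finite K" "\<And>\<kappa>. \<kappa> \<in> K \<Longrightarrow> \<Xi> \<kappa> \<in> int_vectors" "\<And>\<kappa>. \<kappa> \<in> K \<Longrightarrow> C \<kappa> \<ge> 0" "sum C K = 1"
    "\<kappa>0 \<in> K" "\<Xi> \<kappa>0 = 0" "C \<kappa>0 > 0"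
    "\<And>x. \<not> (\<exists>y\<in>int_vectors. \<forall>i. \<bar>(x + y) $ i\<bar> \<le> \<delta>) \<Longrightarrow>
       (\<Sum>\<kappa>\<in>K. C \<kappa> * cos (2 * pi * (\<Xi> \<kappa> \<bullet> x))) \<le> C \<kappa>0 / 2"
proof -
  define \<rho> where "\<rho> = cos (pi * \<delta>) ^ 2"
  have "cos (pi * \<delta>) > 0" using \<delta> by (intro cos_gt_zero_pi) (auto intro: less_trans[of _ 0])
  moreover have "cos (pi * \<delta>) < cos 0" using \<delta> by (intro cos_monotone_0_pi) auto
  ultimately have \<rho>: "0 < \<rho>" "\<rho> < 1" by (auto simp: \<rho>_def power_less_one_iff)
  \<comment> \<open>With a \<open>CARD('k)\<close>-th root the requirement (2N)^k \<rho>^N \<le> 1/2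
    reduces to 2N \<sigma>^N \<le> 1/2, since raising a number below 1 to the power k only decreases
    it.\<close>
  define \<sigma> where "\<sigma> = root CARD('k) \<rho>"
  have \<sigma>: "0 < \<sigma>" "\<sigma> < 1" "\<sigma> ^ CARD('k) = \<rho>" using \<rho> by (auto simp: \<sigma>_def)
  have "(\<lambda>n. 4 * (of_nat n * \<sigma> ^ n)) \<longlonglongrightarrow> 4 * 0"
    using \<sigma> by (intro tendsto_mult tendsto_const powser_times_n_limit_0) auto
  then have "eventually (\<lambda>n. 4 * (of_nat n * \<sigma> ^ n) < 1) sequentially"
    by (rule order_tendstoD) simp
  then have "eventually (\<lambda>n. 4 * (of_nat n * \<sigma> ^ n) < 1 \<and> n > 0) sequentially"
    using eventually_gt_at_top[of 0] by (rule eventually_conj)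
  then obtain N where N: "4 * (real N * \<sigma> ^ N) < 1" "N > 0"
    by (auto simp: eventually_sequentially)
  have small: "\<rho> ^ N \<le> (1 / (2 * real N)) ^ CARD('k) / 2"
  proof -
    have "(2 * real N * \<sigma> ^ N) ^ CARD('k) \<le> (2 * real N * \<sigma> ^ N) ^ 1"
      using N \<sigma> by (intro power_decreasing) (auto simp: Suc_leI)
    also have "\<dots> \<le> 1/2" using N by simp
    finally have "(2 * real N) ^ CARD('k) * \<rho> ^ N \<le> 1/2"
      unfolding \<sigma>(3)[symmetric] by (simp add: power_mult_distrib power_mult[symmetric] mult.commute)
    then show ?thesis using N by (simp add: field_simps power_divide)
  qed
  define K :: "('k \<Rightarrow> nat) set" where "K = PiE UNIV (\<lambda>_. {..2*N})"
  define \<Xi> :: "('k \<Rightarrow> nat) \<Rightarrow> real^'k" where "\<Xi> = (\<lambda>\<kappa>. \<chi> i. real (\<kappa> i) - real N)"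
  define C :: "('k \<Rightarrow> nat) \<Rightarrow> real" where "C = (\<lambda>\<kappa>. \<Prod>i\<in>UNIV. real ((2*N) choose \<kappa> i) / 4 ^ N)"
  have F: "(\<Sum>\<kappa>\<in>K. C \<kappa> * cos (2 * pi * (\<Xi> \<kappa> \<bullet> x))) = (\<Prod>i\<in>UNIV. cos (pi * x $ i) ^ (2 * N))" for x
    unfolding K_def \<Xi>_def C_def by (rule prod_cos_even_power_expansion[symmetric])
  have C0: "C (\<lambda>_. N) \<ge> (1 / (2 * real N)) ^ CARD('k)"
  proof -
    have "1 / (2 * real N) \<le> real ((2*N) choose N) / 4 ^ N"
      using central_binomial_lower_bound[OF N(2)] N(2) by (simp add: field_simps)
    then have "(1 / (2 * real N)) ^ CARD('k) \<le> (real ((2*N) choose N) / 4 ^ N) ^ CARD('k)"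
      by (intro power_mono) auto
    then show ?thesis by (simp add: C_def)
  qed
  show ?thesis
  proof (rule that[of K \<Xi> C "\<lambda>_. N"])
    show "finite K" unfolding K_def by (intro finite_PiE) auto
    show "\<Xi> \<kappa> \<in> int_vectors" for \<kappa> by (auto simp: \<Xi>_def int_vectors_def)
    show "C \<kappa> \<ge> 0" for \<kappa> unfolding C_def by (intro prod_nonneg) auto
    show "sum C K = 1" using F[of 0] by simp
    show "(\<lambda>_. N) \<in> K" by (auto simp: K_def)
    show "\<Xi> (\<lambda>_. N) = 0" by (simp add: \<Xi>_def vec_eq_iff)
    show "C (\<lambda>_. N) > 0" using C0 N by (smt (verit) zero_less_divide_1_iff zero_less_power of_nat_0_less_iff)
    fix x :: "real^'k"
    assume far: "\<not> (\<exists>y\<in>int_vectors. \<forall>i. \<bar>(x + y) $ i\<bar> \<le> \<delta>)"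
    \<comment> \<open>If every coordinate were within \<delta> of an integer, these integers would
      form a \<open>y\<close> contradicting \<open>far\<close>. One far coordinate is enough to make
      the product small, as all other factors are at most 1.\<close>
    obtain i where i: "\<And>n::int. \<bar>x $ i + of_int n\<bar> > \<delta>"
    proof (rule ccontr)
      assume "\<not> thesis"
      then have "\<forall>i. \<exists>n::int. \<bar>x $ i + of_int n\<bar> \<le> \<delta>" using that by (meson not_less)
      then obtain n :: "'k \<Rightarrow> int" where n: "\<And>i. \<bar>x $ i + of_int (n i)\<bar> \<le> \<delta>" by metis
      have "(\<chi> i. real_of_int (n i)) \<in> int_vectors" by (auto simp: int_vectors_def)
      then show False using far n by (auto simp del: not_less dest!: bspec[of _ _ "\<chi> i. real_of_int (n i)"])
    qed
    have le1: "(cos (pi * x $ j) ^ 2) ^ N \<le> 1" for j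
      by (rule power_le_one) (auto simp: abs_square_le_1)
    have "(\<Prod>j\<in>UNIV. cos (pi * x $ j) ^ (2 * N)) = (\<Prod>j\<in>UNIV. (cos (pi * x $ j) ^ 2) ^ N)"
      by (simp add: power_mult)
    also have "\<dots> = (cos (pi * x $ i) ^ 2) ^ N * (\<Prod>j\<in>UNIV-{i}. (cos (pi * x $ j) ^ 2) ^ N)"
      by (rule prod.remove) auto
    also have "\<dots> \<le> \<rho> ^ N * 1"
    proof (rule mult_mono)
      show "(cos (pi * x $ i) ^ 2) ^ N \<le> \<rho> ^ N"
        using cos_sq_le_off_integers[OF \<delta> i] unfolding \<rho>_def by (rule power_mono) simp
      show "(\<Prod>j\<in>UNIV-{i}. (cos (pi * x $ j) ^ 2) ^ N) \<le> 1"
        using le1 by (intro prod_le_1) simp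
      show "0 \<le> (\<Prod>j\<in>UNIV-{i}. (cos (pi * x $ j) ^ 2) ^ N)"
        by (intro prod_nonneg) simp
    qed (use \<rho> in simp)
    also have "\<dots> \<le> C (\<lambda>_. N) / 2" using small C0 by simp
    finally show "(\<Sum>\<kappa>\<in>K. C \<kappa> * cos (2 * pi * (\<Xi> \<kappa> \<bullet> x))) \<le> C (\<lambda>_. N) / 2"
      by (simp only: F)
  qed
qed

text \<open>The bound depends neither on the length of the interval nor on the phase \<beta>, so a
  fast character averages out on any fixed interval.\<close>

lemma integral_cos_ge:
  fixes a b \<alpha> \<beta> :: real
  assumes "a \<le> b" "\<alpha> \<noteq> 0"
  shows "integral {a..b} (\<lambda>t. cos (2 * pi * (t * \<alpha> + \<beta>))) \<ge> - (1 / \<bar>\<alpha>\<bar>)"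
proof -
  let ?f = "\<lambda>t. sin (2 * pi * (t * \<alpha> + \<beta>)) / (2 * pi * \<alpha>)"
  have "((\<lambda>t. cos (2 * pi * (t * \<alpha> + \<beta>))) has_integral (?f b - ?f a)) {a..b}"
    using assms by (intro fundamental_theorem_of_calculus)
      (auto intro!: derivative_eq_intros simp: has_real_derivative_iff_has_vector_derivative[symmetric] field_simps)
  then have I: "integral {a..b} (\<lambda>t. cos (2 * pi * (t * \<alpha> + \<beta>))) = ?f b - ?f a" by blast
  have "\<bar>?f b - ?f a\<bar> = \<bar>sin (2 * pi * (b * \<alpha> + \<beta>)) - sin (2 * pi * (a * \<alpha> + \<beta>))\<bar> / (2 * pi * \<bar>\<alpha>\<bar>)"
    by (simp add: diff_divide_distrib[symmetric] abs_mult)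
  also have "\<dots> \<le> 2 / (2 * pi * \<bar>\<alpha>\<bar>)"
  proof (rule divide_right_mono)
    show "\<bar>sin (2 * pi * (b * \<alpha> + \<beta>)) - sin (2 * pi * (a * \<alpha> + \<beta>))\<bar> \<le> 2"
      using abs_sin_le_one[of "2 * pi * (b * \<alpha> + \<beta>)"] abs_sin_le_one[of "2 * pi * (a * \<alpha> + \<beta>)"] by linarith
  qed auto
  also have "\<dots> \<le> 1 / \<bar>\<alpha>\<bar>"
    using assms pi_gt3 by (simp add: field_simps)
  finally show ?thesis using I by linarith
qed

text \<open>The minorant is integrated along the segment. Its constant term contributes in full,
  characters that are nonnegative on the segment cost nothing, and each fast one costs at most
  \<open>C \<kappa>0 / 4 * (b - a)\<close> by the choice M = 4 / \<open>C \<kappa>0\<close>; the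
  weights sum to 1. The second alternative is what admits a slowly varying character later.\<close>

lemma interval_orbit_hits_cube:
  fixes \<delta> :: real
  assumes \<delta>: "0 < \<delta>" "\<delta> < 1/2"
  obtains S :: "(real^'k) set" and c M :: real where "finite S" "S \<subseteq> int_vectors" "0 < c" "c < 1" "0 < M"
    "\<forall>(z::real^'k) w a b. a < b \<longrightarrow>
      (\<forall>\<xi>\<in>S. \<bar>\<xi> \<bullet> z\<bar> * (b - a) \<ge> M \<or> (\<forall>t\<in>{a..b}. cos (2 * pi * (\<xi> \<bullet> (t *\<^sub>R z + w))) \<ge> 0)) \<longrightarrow>
      (\<exists>G. G \<in> lmeasurable \<and> measure lebesgue G \<ge> c * (b - a) \<and>
        G \<subseteq> {t\<in>{a..b}. \<exists>y\<in>int_vectors. \<forall>i. \<bar>(t *\<^sub>R z + w + y) $ i\<bar> \<le> \<delta>})"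
proof -
  obtain K :: "('k::finite \<Rightarrow> nat) set" and \<Xi> :: "('k \<Rightarrow> nat) \<Rightarrow> real^'k" and C :: "('k \<Rightarrow> nat) \<Rightarrow> real" and \<kappa>0
  where K: "finite K" "\<And>\<kappa>. \<kappa> \<in> K \<Longrightarrow> \<Xi> \<kappa> \<in> int_vectors" "\<And>\<kappa>. \<kappa> \<in> K \<Longrightarrow> C \<kappa> \<ge> 0" "sum C K = 1"
    "\<kappa>0 \<in> K" "\<Xi> \<kappa>0 = 0" "C \<kappa>0 > 0"
    "\<And>x. \<not> (\<exists>y\<in>int_vectors. \<forall>i. \<bar>(x + y) $ i\<bar> \<le> \<delta>) \<Longrightarrow>
       (\<Sum>\<kappa>\<in>K. C \<kappa> * cos (2 * pi * (\<Xi> \<kappa> \<bullet> x))) \<le> C \<kappa>0 / 2"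
    by (rule trig_minorant[OF \<delta>]) (rule that; assumption)
  define c where "c = C \<kappa>0 / 4"
  have Cle: "C \<kappa>0 \<le> 1" using member_le_sum[of \<kappa>0 K C] K(1,3,4,5) by auto
  show ?thesis
  proof (rule that[of "\<Xi> ` K" c "4 / C \<kappa>0"])
    show "finite (\<Xi> ` K)" "\<Xi> ` K \<subseteq> int_vectors" "0 < c" "c < 1" "4 / C \<kappa>0 > 0"
      using K Cle by (auto simp: c_def)
  next
    show "\<forall>(z::real^'k) w a b. a < b \<longrightarrow>
      (\<forall>\<xi>\<in>\<Xi> ` K. \<bar>\<xi> \<bullet> z\<bar> * (b - a) \<ge> 4 / C \<kappa>0 \<or> (\<forall>t\<in>{a..b}. cos (2 * pi * (\<xi> \<bullet> (t *\<^sub>R z + w))) \<ge> 0)) \<longrightarrow>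
      (\<exists>G. G \<in> lmeasurable \<and> measure lebesgue G \<ge> c * (b - a) \<and>
        G \<subseteq> {t\<in>{a..b}. \<exists>y\<in>int_vectors. \<forall>i. \<bar>(t *\<^sub>R z + w + y) $ i\<bar> \<le> \<delta>})"
    proof (intro allI impI)
      fix z w :: "real^'k" and a b :: real
      assume ab: "a < b" and alt: "\<forall>\<xi>\<in>\<Xi> ` K. \<bar>\<xi> \<bullet> z\<bar> * (b - a) \<ge> 4 / C \<kappa>0 \<or>
         (\<forall>t\<in>{a..b}. cos (2 * pi * (\<xi> \<bullet> (t *\<^sub>R z + w))) \<ge> 0)"
      define F where "F = (\<lambda>t. \<Sum>\<kappa>\<in>K. C \<kappa> * cos (2 * pi * (\<Xi> \<kappa> \<bullet> (t *\<^sub>R z + w))))"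
      define G where "G = {a..b} \<inter> {t. F t > C \<kappa>0 / 2}"
      have Fc: "continuous_on UNIV F" unfolding F_def by (intro continuous_intros)
      have G: "G \<in> lmeasurable"
      proof -
        have "open {t. F t > C \<kappa>0 / 2}" by (intro open_Collect_less continuous_intros Fc)
        then have "{t. F t > C \<kappa>0 / 2} \<in> sets lebesgue" by simp
        then show ?thesis unfolding G_def by (intro fmeasurable_Int_fmeasurable) auto
      qed
      have GI: "G \<inter> {a..b} = G" "{a..b} \<inter> G = G" by (auto simp: G_def)
      have F1: "F t \<le> 1" for t
      proof -
        have "F t \<le> (\<Sum>\<kappa>\<in>K. C \<kappa> * 1)" unfolding F_def using K(3) by (intro sum_mono mult_left_mono) auto
        then show ?thesis using K(4) by simp
      qed
      have int_lower: "integral {a..b} (\<lambda>t. cos (2 * pi * (\<Xi> \<kappa> \<bullet> (t *\<^sub>R z + w)))) \<ge> (if \<kappa> = \<kappa>0 then b - a else 0) - C \<kappa>0 / 4 * (b - a)"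
        if \<kappa>: "\<kappa> \<in> K" for \<kappa>
      proof (cases "\<kappa> = \<kappa>0")
        case True
        then show ?thesis using K(6,7) ab by simp
      next
        case False
        from alt \<kappa> consider "\<bar>\<Xi> \<kappa> \<bullet> z\<bar> * (b - a) \<ge> 4 / C \<kappa>0" | "\<forall>t\<in>{a..b}. cos (2 * pi * (\<Xi> \<kappa> \<bullet> (t *\<^sub>R z + w))) \<ge> 0"
          by blast
        then show ?thesis
        proof cases
          case 1
          then have nz: "\<Xi> \<kappa> \<bullet> z \<noteq> 0" using K(7) by auto
          have "integral {a..b} (\<lambda>t. cos (2 * pi * (t * (\<Xi> \<kappa> \<bullet> z) + \<Xi> \<kappa> \<bullet> w))) \<ge> - (1 / \<bar>\<Xi> \<kappa> \<bullet> z\<bar>)"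
            using ab nz by (intro integral_cos_ge) auto
          moreover have "1 / \<bar>\<Xi> \<kappa> \<bullet> z\<bar> \<le> C \<kappa>0 / 4 * (b - a)"
            using 1 K(7) nz by (simp add: field_simps)
          ultimately show ?thesis using False by (simp add: inner_add_right)
        next
          case 2
          then have "0 \<le> integral {a..b} (\<lambda>t. cos (2 * pi * (\<Xi> \<kappa> \<bullet> (t *\<^sub>R z + w))))"
            by (intro integral_nonneg integrable_continuous_real continuous_intros) auto
          moreover have "0 \<le> C \<kappa>0 / 4 * (b - a)" using K(7) ab by simp
          ultimately show ?thesis using False by simp
        qed
      qed
      have "integral {a..b} F = (\<Sum>\<kappa>\<in>K. C \<kappa> * integral {a..b} (\<lambda>t. cos (2 * pi * (\<Xi> \<kappa> \<bullet> (t *\<^sub>R z + w)))))"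
        unfolding F_def using K(1)
        by (subst integral_sum) (auto intro!: integrable_continuous_real continuous_intros)
      also have "\<dots> \<ge> (\<Sum>\<kappa>\<in>K. C \<kappa> * ((if \<kappa> = \<kappa>0 then b - a else 0) - C \<kappa>0 / 4 * (b - a)))"
        using K(3) int_lower by (intro sum_mono mult_left_mono) auto
      also have "(\<Sum>\<kappa>\<in>K. C \<kappa> * ((if \<kappa> = \<kappa>0 then b - a else 0) - C \<kappa>0 / 4 * (b - a)))
        = (\<Sum>\<kappa>\<in>K. if \<kappa> = \<kappa>0 then C \<kappa> * (b - a) else 0) - (\<Sum>\<kappa>\<in>K. C \<kappa>) * (C \<kappa>0 / 4 * (b - a))"
        by (simp only: sum_distrib_right sum_subtractf[symmetric]) (auto intro!: sum.cong simp: algebra_simps)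
      also have "\<dots> = C \<kappa>0 * (b - a) - C \<kappa>0 / 4 * (b - a)"
        using K(1,4,5) by (simp add: sum.delta)
      finally have lower: "integral {a..b} F \<ge> C \<kappa>0 * (b - a) - C \<kappa>0 / 4 * (b - a)" .
      \<comment> \<open>\<open>F\<close> is at most 1 on \<open>G\<close> and at most
        \<open>C \<kappa>0 / 2\<close> off it. The gap between 3/4 and 1/2 of the constant
        coefficient is the proportion \<open>c\<close>.\<close>
      have "integral {a..b} F \<le> integral {a..b} (\<lambda>t. C \<kappa>0 / 2 + indicator G t)"
      proof (rule integral_le)
        show "F integrable_on {a..b}" using Fc by (intro integrable_continuous_real) (auto intro: continuous_on_subset)
        show "(\<lambda>t. C \<kappa>0 / 2 + indicator G t) integrable_on {a..b}"
          using G by (intro integrable_add integrable_const_ivl) (auto simp: integrable_on_indicator GI)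
        fix t assume "t \<in> {a..b}"
        then show "F t \<le> C \<kappa>0 / 2 + indicator G t"
          using F1[of t] K(7) by (auto simp: G_def indicator_def)
      qed
      also have "\<dots> = C \<kappa>0 / 2 * (b - a) + integral {a..b} (indicator G)"
        using G ab by (subst integral_add) (auto simp: integrable_on_indicator GI)
      also have "integral {a..b} (indicator G) = measure lebesgue G"
        using G by (subst integral_indicator) (auto simp: GI)
      finally have "measure lebesgue G \<ge> c * (b - a)" using lower by (simp add: c_def field_simps)
      moreover have "G \<subseteq> {t\<in>{a..b}. \<exists>y\<in>int_vectors. \<forall>i. \<bar>(t *\<^sub>R z + w + y) $ i\<bar> \<le> \<delta>}"
      proof
        fix t assume t: "t \<in> G"
        then have "\<not> F t \<le> C \<kappa>0 / 2" by (simp add: G_def)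
        then have "\<exists>y\<in>int_vectors. \<forall>i. \<bar>(t *\<^sub>R z + w + y) $ i\<bar> \<le> \<delta>"
          using K(8)[of "t *\<^sub>R z + w"] unfolding F_def by blast
        then show "t \<in> {t\<in>{a..b}. \<exists>y\<in>int_vectors. \<forall>i. \<bar>(t *\<^sub>R z + w + y) $ i\<bar> \<le> \<delta>}"
          using t by (simp add: G_def)
      qed
      ultimately show "\<exists>G. G \<in> lmeasurable \<and> measure lebesgue G \<ge> c * (b - a) \<and>
          G \<subseteq> {t\<in>{a..b}. \<exists>y\<in>int_vectors. \<forall>i. \<bar>(t *\<^sub>R z + w + y) $ i\<bar> \<le> \<delta>}"
        using G by blast
    qed
  qed
qed

subsection \<open>Lattices and the diagonal flow\<close>

definition integral_matrix :: "real^'k^'k \<Rightarrow> bool" where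
  "integral_matrix M \<longleftrightarrow> (\<forall>i j. M $ i $ j \<in> \<int>)"

lemma int_vectors_0: "0 \<in> int_vectors"
  by (simp add: int_vectors_def)

lemma int_vectors_axis: "axis i 1 \<in> int_vectors"
  by (auto simp: int_vectors_def axis_def)

lemma int_vectors_uminus: "x \<in> int_vectors \<Longrightarrow> - x \<in> int_vectors"
  by (simp add: int_vectors_def)

lemma int_vectors_inner: "x \<in> int_vectors \<Longrightarrow> y \<in> int_vectors \<Longrightarrow> x \<bullet> y \<in> \<int>"
  by (auto simp: int_vectors_def inner_vec_def intro!: Ints_sum Ints_mult)

lemma int_vectors_mult: "integral_matrix M \<Longrightarrow> x \<in> int_vectors \<Longrightarrow> M *v x \<in> int_vectors"
  by (auto simp: int_vectors_def integral_matrix_def matrix_vector_mult_def intro!: Ints_sum Ints_mult)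

lemma int_vectors_vmult: "integral_matrix M \<Longrightarrow> x \<in> int_vectors \<Longrightarrow> x v* M \<in> int_vectors"
  by (auto simp: int_vectors_def integral_matrix_def vector_matrix_mult_def intro!: Ints_sum Ints_mult)

lemma integral_matrixI: "(\<And>j. M *v axis j 1 \<in> int_vectors) \<Longrightarrow> integral_matrix M"
  by (simp add: integral_matrix_def int_vectors_def matrix_vector_mult_basis column_def)

lemma det_integral_matrix: "integral_matrix M \<Longrightarrow> det M \<in> \<int>"
  unfolding det_def integral_matrix_def by (intro Ints_sum Ints_mult Ints_prod) auto

lemma det_1_inverse:
  fixes g :: "real^'k^'k"
  assumes "det g = 1"
  obtains g' where "g ** g' = mat 1" "g' ** g = mat 1"
  using assms invertible_det_nz[of g] by (auto simp: invertible_def)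

lemma image_lattice_of: "(\<lambda>v. A *v v) ` lattice_of B = lattice_of (A ** B)"
  by (simp add: lattice_of_def image_image matrix_vector_mul_assoc)

lemma lattice_of_mult_integral:
  assumes "integral_matrix \<gamma>" "integral_matrix \<gamma>'" "\<gamma> ** \<gamma>' = mat 1"
  shows "lattice_of (g ** \<gamma>) = lattice_of g"
proof -
  have "(\<lambda>v. \<gamma> *v v) ` int_vectors = int_vectors"
  proof (intro equalityI subsetI)
    fix x assume "x \<in> (\<lambda>v. \<gamma> *v v) ` int_vectors"
    then show "x \<in> int_vectors" using assms(1) int_vectors_mult by blast
  next
    fix x :: "real^'a" assume "x \<in> int_vectors"
    then have "\<gamma>' *v x \<in> int_vectors" using assms(2) int_vectors_mult by blast
    moreover have "x = \<gamma> *v (\<gamma>' *v x)" by (simp add: matrix_vector_mul_assoc assms(3))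
    ultimately show "x \<in> (\<lambda>v. \<gamma> *v v) ` int_vectors" by blast
  qed
  then show ?thesis
    unfolding lattice_of_def matrix_vector_mul_assoc[symmetric] image_image[symmetric, of "(*v) g" "(*v) \<gamma>"]
    by simp
qed

text \<open>Each basis lies in the lattice of the other, so the transition matrix and its inverse
  both have integer entries.\<close>

lemma lattice_of_eqE:
  fixes g g' :: "real^'k^'k"
  assumes d: "det g = 1" "det g' = 1" and eq: "lattice_of g = lattice_of g'"
  obtains \<gamma> \<gamma>' where "integral_matrix \<gamma>" "integral_matrix \<gamma>'" "\<gamma> ** \<gamma>' = mat 1" "\<gamma>' ** \<gamma> = mat 1"
    "det \<gamma> = 1" "g' = g ** \<gamma>"
proof -
  obtain h where h: "g ** h = mat 1" "h ** g = mat 1" using det_1_inverse d(1) by blast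
  obtain h' where h': "g' ** h' = mat 1" "h' ** g' = mat 1" using det_1_inverse d(2) by blast
  have int: "integral_matrix (b ** a')"
    if "b ** a = mat 1" "lattice_of a = lattice_of a'" for a a' b :: "real^'k^'k"
  proof (rule integral_matrixI)
    fix j
    have "a' *v axis j 1 \<in> lattice_of a" unfolding that(2) using int_vectors_axis[of j] by (simp add: lattice_of_def)
    then obtain y where y: "y \<in> int_vectors" "a' *v axis j 1 = a *v y" by (auto simp: lattice_of_def)
    have "(b ** a') *v axis j 1 = b *v (a *v y)" by (simp add: matrix_vector_mul_assoc[symmetric] y(2))
    then show "(b ** a') *v axis j 1 \<in> int_vectors" using y(1) that(1) by (simp add: matrix_vector_mul_assoc)
  qed
  have dh: "det h = 1" using arg_cong[OF h(1), of det] d by (simp add: det_mul)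
  show ?thesis
  proof (rule that[of "h ** g'" "h' ** g"])
    show "integral_matrix (h ** g')" "integral_matrix (h' ** g)" using int h h' eq by auto
    show "h ** g' ** (h' ** g) = mat 1"
      by (metis h(2) h'(1) matrix_mul_assoc matrix_mul_rid)
    show "h' ** g ** (h ** g') = mat 1"
      by (metis h(1) h'(2) matrix_mul_assoc matrix_mul_rid)
    show "det (h ** g') = 1" using dh d by (simp add: det_mul)
    show "g' = g ** (h ** g')" by (simp add: matrix_mul_assoc h)
  qed
qed

section \<open>Continuity of matrix operations and lifting limits of lattices to matrices\<close>

lemma continuous_on_matrix_mult [continuous_intros]:
  fixes f :: "'t::topological_space \<Rightarrow> real^'k^'l" and g :: "'t \<Rightarrow> real^'n^'k"
  assumes "continuous_on S f" "continuous_on S g"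
  shows "continuous_on S (\<lambda>x. f x ** g x)"
  unfolding matrix_matrix_mult_def by (intro continuous_intros assms)

lemma continuous_on_matrix_vector_mult' [continuous_intros]:
  fixes f :: "'t::topological_space \<Rightarrow> real^'k^'l" and g :: "'t \<Rightarrow> real^'k"
  assumes "continuous_on S f" "continuous_on S g"
  shows "continuous_on S (\<lambda>x. f x *v g x)"
  unfolding matrix_vector_mult_def by (intro continuous_intros assms)

lemma continuous_on_det [continuous_intros]:
  fixes f :: "'t::topological_space \<Rightarrow> real^'k^'k"
  assumes "continuous_on S f"
  shows "continuous_on S (\<lambda>x. det (f x))"
  unfolding det_def by (intro continuous_intros assms)

text \<open>The quotient map is open: the preimage of the image is a union of translates of
  \<open>SL \<inter> O'\<close> by integral matrices of determinant 1, and each translate is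
  relatively open.\<close>

lemma openin_image_lattice_of:
  fixes O' :: "(real^'k^'k) set"
  assumes "open O'"
  shows "openin lattice_topology (lattice_of ` (SL \<inter> O'))"
  unfolding openin_lattice_topology
proof
  show "lattice_of ` (SL \<inter> O') \<subseteq> unimodular_lattices" by (auto simp: unimodular_lattices_def)
  show "openin (top_of_set SL) {g \<in> SL. lattice_of g \<in> lattice_of ` (SL \<inter> O')}" (is "openin _ ?P")
  proof (subst openin_subopen, intro ballI)
    fix g assume "g \<in> ?P"
    then obtain u where u: "u \<in> SL" "u \<in> O'" "g \<in> SL" "lattice_of g = lattice_of u" by auto
    then have d: "det g = 1" "det u = 1" by (simp_all add: SL_def)
    obtain \<gamma> \<gamma>' where \<gamma>: "integral_matrix \<gamma>" "integral_matrix \<gamma>'" "\<gamma> ** \<gamma>' = mat 1"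
      "\<gamma>' ** \<gamma> = mat 1" "det \<gamma> = 1" "u = g ** \<gamma>"
      by (rule lattice_of_eqE[OF d u(4)])
    let ?V = "SL \<inter> (\<lambda>M. M ** \<gamma>) -` O'"
    have "open ((\<lambda>M. M ** \<gamma>) -` O')"
      by (intro open_vimage assms continuous_intros)
    then have "openin (top_of_set SL) ?V" by (simp add: openin_open_Int)
    moreover have "g \<in> ?V" using u \<gamma> by simp
    moreover have "?V \<subseteq> ?P"
    proof
      fix M assume M: "M \<in> ?V"
      then have "M ** \<gamma> \<in> SL \<inter> O'" using \<gamma>(5) by (auto simp: SL_def det_mul)
      moreover have "lattice_of (M ** \<gamma>) = lattice_of M" using lattice_of_mult_integral[OF \<gamma>(1-3)] .
      ultimately show "M \<in> ?P" using M by (metis (mono_tags, lifting) IntD1 image_eqI mem_Collect_eq)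
    qed
    ultimately show "\<exists>T. openin (top_of_set SL) T \<and> g \<in> T \<and> T \<subseteq> ?P" by blast
  qed
qed

text \<open>Openness of \<open>lattice_of\<close> on a ball around \<open>g\<close> turns
  convergence of lattices into the existence of one basis near \<open>g\<close>; no convergent lift
  of the whole sequence has to be chosen.\<close>

lemma boundary_set_approx:
  fixes g :: "real^('m::finite + 'n::finite)^('m + 'n)"
  assumes y: "lattice_of g \<in> boundary_set x" and g: "det g = 1" and e: "e > 0"
  obtains t g' where "t \<ge> R" "det g' = 1" "dist g' g < e" "lattice_of g' = (\<lambda>v. h_mat t *v v) ` x"
proof -
  obtain t :: "nat \<Rightarrow> real" where t: "\<And>k. 0 \<le> t k" "\<not> bounded (range t)"
    and lim: "limitin lattice_topology (\<lambda>k. (\<lambda>v. h_mat (t k) *v v) ` x) (lattice_of g) sequentially"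
    using y by (auto simp: boundary_set_def)
  have "openin lattice_topology (lattice_of ` (SL \<inter> ball g e))" by (intro openin_image_lattice_of) auto
  moreover have "lattice_of g \<in> lattice_of ` (SL \<inter> ball g e)" using g e by (auto simp: SL_def)
  ultimately have "\<forall>\<^sub>F k in sequentially. (\<lambda>v. h_mat (t k) *v v) ` x \<in> lattice_of ` (SL \<inter> ball g e)"
    using lim unfolding limitin_def by blast
  then obtain K where K: "\<And>k. k \<ge> K \<Longrightarrow> (\<lambda>v. h_mat (t k) *v v) ` x \<in> lattice_of ` (SL \<inter> ball g e)"
    by (auto simp: eventually_sequentially)
  \<comment> \<open>The first \<open>K\<close> times form a finite set, so the unboundedness comes
    from later indices.\<close>
  have "\<exists>k\<ge>K. t k \<ge> R"
  proof (rule ccontr)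
    assume "\<not> ?thesis"
    then have "range t \<subseteq> t ` {..<K} \<union> {0..R}" using t(1) by (force simp: not_le)
    then have "bounded (range t)" by (rule bounded_subset[rotated]) (auto intro: finite_imp_bounded)
    then show False using t(2) by blast
  qed
  then obtain k where k: "k \<ge> K" "t k \<ge> R" by blast
  then obtain g' where "g' \<in> SL \<inter> ball g e" "(\<lambda>v. h_mat (t k) *v v) ` x = lattice_of g'"
    using K by blast
  then show ?thesis using k by (intro that[of "t k" g']) (auto simp: SL_def dist_commute)
qed

section \<open>Weights of the diagonal flow\<close>

definition h_diag :: "real \<Rightarrow> 'm::finite + 'n::finite \<Rightarrow> real" where
  "h_diag t i = (case i of Inl _ \<Rightarrow> exp (real CARD('n) * t) | Inr _ \<Rightarrow> exp (- real CARD('m) * t))"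

lemma h_mat_nth: "h_mat t $ i $ j = (if i = j then h_diag t i else 0)"
  by (simp add: h_mat_def h_diag_def)

lemma h_mat_mult_vec: "(h_mat t *v v) $ i = h_diag t i * v $ i"
  by (simp add: matrix_vector_mult_def h_mat_nth if_distrib if_distribR sum.delta cong: if_cong)

lemma h_mat_add: "h_mat s ** h_mat t = h_mat (s + t)"
proof -
  have "h_diag s i * h_diag t i = h_diag (s + t) i" for i :: "'a + 'b"
    by (cases i) (simp_all add: h_diag_def exp_add[symmetric] algebra_simps)
  then show ?thesis
    by (simp add: matrix_eq matrix_vector_mul_assoc[symmetric] vec_eq_iff h_mat_mult_vec mult.assoc[symmetric])
qed

lemma h_mat_row: "(h_mat t ** M) $ i = h_diag t i *s M $ i"
  by (simp add: matrix_matrix_mult_def vec_eq_iff h_mat_nth if_distrib if_distribR sum.delta cong: if_cong)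

text \<open>This is the factor by which the flow multiplies a minor formed from the rows in
  \<open>S\<close>.\<close>

lemma prod_h_diag:
  fixes S :: "('m::finite + 'n::finite) set"
  shows "(\<Prod>i\<in>S. h_diag t i) =
    exp (t * (real CARD('n) * real (card (Inl -` S :: 'm set)) - real CARD('m) * real (card (Inr -` S :: 'n set))))"
proof -
  have S: "S = Inl ` (Inl -` S) \<union> Inr ` (Inr -` S)" (is "_ = ?A \<union> ?B")
  proof (intro equalityI subsetI)
    fix x assume "x \<in> S" then show "x \<in> ?A \<union> ?B" by (cases x) auto
  qed auto
  have "(\<Prod>i\<in>S. h_diag t i) = (\<Prod>i\<in>?A. h_diag t i) * (\<Prod>i\<in>?B. h_diag t i)"
    by (subst S, rule prod.union_disjoint) auto
  also have "(\<Prod>i\<in>?A. h_diag t i) = exp (real CARD('n) * t) ^ card (Inl -` S :: 'm set)"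
    by (subst prod.reindex) (auto simp: h_diag_def)
  also have "(\<Prod>i\<in>?B. h_diag t i) = exp (- real CARD('m) * t) ^ card (Inr -` S :: 'n set)"
    by (subst prod.reindex) (auto simp: h_diag_def)
  also have "exp (real CARD('n) * t) ^ card (Inl -` S :: 'm set) * exp (- real CARD('m) * t) ^ card (Inr -` S :: 'n set) =
      exp (t * (real CARD('n) * real (card (Inl -` S :: 'm set)) - real CARD('m) * real (card (Inr -` S :: 'n set))))"
    by (simp add: exp_of_nat_mult[symmetric] exp_add[symmetric] algebra_simps)
  finally show ?thesis .
qed

lemma det_h_mat: "det (h_mat t :: real^('m::finite + 'n::finite)^('m + 'n)) = 1"
proof -
  let ?h = "h_mat t :: real^('m + 'n)^('m + 'n)"
  have "det ?h = (\<Prod>i\<in>UNIV. ?h $ i $ i)" by (rule det_diagonal) (simp add: h_mat_nth)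
  also have "\<dots> = (\<Prod>i\<in>(UNIV :: ('m + 'n) set). h_diag t i)" by (simp add: h_mat_nth)
  also have "\<dots> = 1" by (simp add: prod_h_diag)
  finally show ?thesis .
qed

text \<open>If n a = m b, coprimality makes m divide a, and a \<le> m leaves a = 0 or a = m. Then b
  = 0 or b = n respectively, so \<open>S\<close> is empty or full.\<close>

lemma coprime_weight_nonzero:
  fixes S :: "('m::finite + 'n::finite) set"
  assumes cop: "coprime CARD('m) CARD('n)" and S: "S \<noteq> {}" "S \<noteq> UNIV"
  shows "real CARD('n) * real (card (Inl -` S :: 'm set)) - real CARD('m) * real (card (Inr -` S :: 'n set)) \<noteq> 0"
proof
  let ?a = "card (Inl -` S :: 'm set)" and ?b = "card (Inr -` S :: 'n set)"
  assume "real CARD('n) * real ?a - real CARD('m) * real ?b = 0"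
  then have eq: "CARD('n) * ?a = CARD('m) * ?b" by (simp flip: of_nat_mult)
  then have "CARD('m) dvd CARD('n) * ?a" by simp
  then have "CARD('m) dvd ?a" using cop coprime_dvd_mult_right_iff by blast
  moreover have "?a \<le> CARD('m)" by (intro card_mono) auto
  ultimately consider "?a = 0" | "?a = CARD('m)" by (meson dvd_imp_le le_antisym not_gr_zero)
  then show False
  proof cases
    case 1
    then have "?b = 0" using eq by simp
    with 1 have "Inl -` S = ({} :: 'm set)" "Inr -` S = ({} :: 'n set)" by auto
    then have "x \<notin> S" for x by (cases x) blast+
    then show False using S(1) by blast
  next
    case 2
    then have "?b = CARD('n)" using eq by simp
    with 2 have "Inl -` S = (UNIV :: 'm set)" "Inr -` S = (UNIV :: 'n set)"
      using card_subset_eq[of UNIV "Inl -` S :: 'm set"] card_subset_eq[of UNIV "Inr -` S :: 'n set"] by auto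
    then have "x \<in> S" for x by (cases x) blast+
    then show False using S(2) by blast
  qed
qed

subsection \<open>Determinants with prescribed rows\<close>

text \<open>Steinitz exchange: independent vectors extend to a basis by rows of \<open>g\<close>,
  and \<tau> records the rows used. Its injectivity later turns the flow's effect on them into a
  product over a set of rows.\<close>

lemma det_frame_exists:
  fixes g :: "real^'k^'k" and v :: "'k \<Rightarrow> real^'k"
  assumes g: "det g \<noteq> 0" and v: "inj_on v S" "independent (v ` S)"
  obtains \<tau> where "inj_on \<tau> (- S)" "det (\<chi> i. if i \<in> S then v i else g $ \<tau> i) \<noteq> 0"
proof -
  have gspan: "span (rows g) = UNIV"
    using g by (metis invertible_det_nz invertible_left_inverse matrix_left_invertible_span_rows)
  obtain B where B: "v ` S \<subseteq> B" "B \<subseteq> v ` S \<union> rows g" "independent B" "v ` S \<union> rows g \<subseteq> span B"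
    using maximal_independent_subset_extend[of "v ` S" "v ` S \<union> rows g"] v(2) by blast
  have Bspan: "span B = UNIV"
    using B(4) gspan by (metis Un_subset_iff span_mono span_span top.extremum_unique)
  have "card B = CARD('k)"
    using dim_eq_card_independent[OF B(3)] Bspan by (metis DIM_cart DIM_real dim_UNIV dim_span mult_1_right)
  moreover have "finite B" using B(3) independent_bound by blast
  ultimately have "card (B - v ` S) = card (- S)"
    using B(1) v(1) by (simp add: card_Diff_subset card_image Compl_eq_Diff_UNIV finite_subset)
  then obtain \<phi> where \<phi>: "bij_betw \<phi> (- S) (B - v ` S)"
    using finite_same_card_bij[of "- S" "B - v ` S"] \<open>finite B\<close> by auto
  have "\<exists>k. g $ k = \<phi> i" if "i \<in> - S" for i
  proof -
    have "\<phi> i \<in> B - v ` S" using \<phi> that by (meson bij_betwE)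
    then have "\<phi> i \<in> rows g" using B(2) by blast
    then show ?thesis by (auto simp: rows_def row_def)
  qed
  then obtain \<tau> where \<tau>: "\<And>i. i \<in> - S \<Longrightarrow> g $ \<tau> i = \<phi> i" by metis
  let ?M = "\<chi> i. if i \<in> S then v i else g $ \<tau> i"
  have "B \<subseteq> rows ?M"
  proof
    fix b assume b: "b \<in> B"
    have "\<exists>i. ?M $ i = b"
    proof (cases "b \<in> v ` S")
      case True then show ?thesis by (auto intro: exI)
    next
      case False
      then obtain i where "i \<in> - S" "\<phi> i = b" using b \<phi> by (metis Diff_iff bij_betw_imp_surj_on imageE)
      then show ?thesis using \<tau>[of i] by (intro exI[of _ i]) simp
    qed
    then show "b \<in> rows ?M" by (auto simp: rows_def row_def)
  qed
  then have "span (rows ?M) = UNIV" using Bspan by (metis span_mono top.extremum_unique)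
  then have "det ?M \<noteq> 0"
    by (metis invertible_det_nz invertible_left_inverse matrix_left_invertible_span_rows)
  moreover have "inj_on \<tau> (- S)"
    using \<tau> \<phi> by (metis (no_types, lifting) bij_betw_imp_inj_on inj_on_def)
  ultimately show ?thesis using that by blast
qed

lemma det_frame_independent:
  fixes v u :: "'k \<Rightarrow> real^'k"
  assumes d: "det (\<chi> i. if i \<in> S then v i else u i) \<noteq> 0"
  shows "inj_on v S" "independent (v ` S)"
proof -
  let ?M = "\<chi> i. if i \<in> S then v i else u i"
  have row: "row i ?M = v i" if "i \<in> S" for i using that by (simp add: row_def vec_eq_iff)
  show "inj_on v S"
  proof (rule inj_onI, rule ccontr)
    fix i j assume "i \<in> S" "j \<in> S" "v i = v j" "i \<noteq> j"
    then show False using d det_identical_rows[of i j ?M] row by simp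
  qed
  have "v ` S \<subseteq> rows ?M"
  proof
    fix x assume "x \<in> v ` S"
    then obtain i where "i \<in> S" "x = v i" by blast
    then show "x \<in> rows ?M" unfolding rows_def using row[of i] by (intro CollectI exI[of _ i]) auto
  qed
  moreover have "independent (rows ?M)" using d det_dependent_rows[of ?M] by (auto simp: dependent_vec_eq)
  ultimately show "independent (v ` S)" by (rule independent_mono[rotated])
qed

text \<open>The coefficient matrix on \<open>S\<close>, extended by the identity elsewhere,
  multiplies the frame from the left. \<open>D\<close> is its determinant, so one factor serves all
  completions \<open>u\<close> at once.\<close>

lemma det_frame_change_of_basis:
  fixes v v' :: "'k \<Rightarrow> real^'k"
  assumes inj: "inj_on v S" and sp: "\<And>i. i \<in> S \<Longrightarrow> v' i \<in> span (v ` S)"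
  obtains D where "\<And>u. det (\<chi> i. if i \<in> S then v' i else u i) = D * det (\<chi> i. if i \<in> S then v i else u i)"
proof -
  have "\<exists>c. v' i = (\<Sum>k\<in>S. c k *\<^sub>R v k)" if i: "i \<in> S" for i
  proof -
    obtain c where "v' i = (\<Sum>x\<in>v ` S. c x *\<^sub>R x)"
      using sp[OF i] span_finite[of "v ` S"] by auto
    then have "v' i = (\<Sum>k\<in>S. c (v k) *\<^sub>R v k)" by (simp add: sum.reindex[OF inj])
    then show ?thesis by (intro exI[of _ "\<lambda>k. c (v k)"])
  qed
  then obtain c where c: "\<And>i. i \<in> S \<Longrightarrow> v' i = (\<Sum>k\<in>S. c i k *\<^sub>R v k)" by metis
  define B :: "real^'k^'k" where "B = (\<chi> i k. if i \<in> S then (if k \<in> S then c i k else 0) else (if i = k then 1 else 0))"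
  have "det (\<chi> i. if i \<in> S then v' i else u i) = det B * det (\<chi> i. if i \<in> S then v i else u i)" for u
  proof -
    let ?M = "\<chi> i. if i \<in> S then v i else u i"
    have "(B ** ?M) $ i = (\<chi> i. if i \<in> S then v' i else u i) $ i" for i
    proof (cases "i \<in> S")
      case True
      have "(B ** ?M) $ i $ j = v' i $ j" for j
      proof -
        have "(B ** ?M) $ i $ j = (\<Sum>k\<in>UNIV. if k \<in> S then c i k * v k $ j else 0)"
          unfolding matrix_matrix_mult_def B_def vec_lambda_beta
          by (rule sum.cong) (use True in auto)
        also have "\<dots> = (\<Sum>k\<in>S. c i k * v k $ j)" by (simp add: sum.If_cases)
        also have "\<dots> = v' i $ j" by (simp add: c[OF True])
        finally show ?thesis .
      qed
      then show ?thesis using True by (simp add: vec_eq_iff)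
    next
      case False
      have "(B ** ?M) $ i $ j = u i $ j" for j
      proof -
        have "(B ** ?M) $ i $ j = (\<Sum>k\<in>UNIV. if k = i then u k $ j else 0)"
          unfolding matrix_matrix_mult_def B_def vec_lambda_beta
          by (rule sum.cong) (use False in auto)
        then show ?thesis by simp
      qed
      then show ?thesis using False by (simp add: vec_eq_iff)
    qed
    then have "B ** ?M = (\<chi> i. if i \<in> S then v' i else u i)" by (simp add: vec_eq_iff)
    then show ?thesis using det_mul[of B ?M] by simp
  qed
  then show ?thesis using that by blast
qed

lemma frame_matrix_mult:
  fixes v u :: "'k \<Rightarrow> real^'k"
  shows "(\<chi> i. if i \<in> S then v i else u i) ** M = (\<chi> i. if i \<in> S then v i v* M else u i v* M)"
  by (auto simp: vec_eq_iff matrix_matrix_mult_def vector_matrix_mult_def mult.commute intro!: sum.cong)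

lemma row_mult: "(A ** B) $ i = (A $ i) v* B"
  by (simp add: vec_eq_iff matrix_matrix_mult_def vector_matrix_mult_def)

lemma linear_vmult: "linear (\<lambda>x. x v* (M :: real^'k^'n))"
  by (intro linearI) (simp_all add: vector_matrix_left_distrib scaleR_vector_matrix_assoc)

lemma det_frame_h_mat:
  fixes w :: "'m::finite + 'n::finite \<Rightarrow> real^('m + 'n)" and M :: "real^('m + 'n)^('m + 'n)"
  assumes "inj_on \<tau> (- S)"
  shows "det (\<chi> i. if i \<in> S then w i else (h_mat t ** M) $ \<tau> i) =
    (\<Prod>k\<in>\<tau> ` (- S). h_diag t k) * det (\<chi> i. if i \<in> S then w i else M $ \<tau> i)"
proof -
  have "(\<chi> i. if i \<in> S then w i else (h_mat t ** M) $ \<tau> i) =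
      (\<chi> i. (if i \<in> S then 1 else h_diag t (\<tau> i)) *s (if i \<in> S then w i else M $ \<tau> i))"
    by (simp add: vec_eq_iff h_mat_row)
  then have "det (\<chi> i. if i \<in> S then w i else (h_mat t ** M) $ \<tau> i) =
    (\<Prod>i\<in>UNIV. if i \<in> S then 1 else h_diag t (\<tau> i)) * det (\<chi> i. if i \<in> S then w i else M $ \<tau> i)"
    by (simp only: det_rows_mul)
  also have "(\<Prod>i\<in>UNIV. if i \<in> S then 1 else h_diag t (\<tau> i)) = (\<Prod>i\<in>- S. h_diag t (\<tau> i))"
    by (simp add: prod.If_cases Compl_eq)
  also have "\<dots> = (\<Prod>k\<in>\<tau> ` (- S). h_diag t k)" using assms by (simp add: prod.reindex)
  finally show ?thesis .
qed

text \<open>The determinants below are the Pluecker coordinates of the span of the rows indexed by \<open>S\<close>.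
  The family \<open>w\<close> minimises one such nonzero integer, so integral changes of basis within the span
  have determinant of absolute value 1.\<close>

lemma no_persistent_subspace:
  fixes g g' :: "real^('m::finite + 'n::finite)^('m + 'n)" and s :: "nat \<Rightarrow> real"
    and v :: "'m + 'n \<Rightarrow> real^('m + 'n)"
  assumes cop: "coprime CARD('m) CARD('n)"
    and S: "S \<noteq> {}" "S \<noteq> UNIV" and W: "subspace W" "dim W = card S"
    and s: "filterlim s at_top sequentially"
    and \<gamma>: "\<And>j. integral_matrix (\<gamma> j)" "\<And>j. integral_matrix (\<gamma>' j)" "\<And>j. \<gamma> j ** \<gamma>' j = mat 1"
      "\<And>j. \<gamma>' j ** \<gamma> j = mat 1" "\<And>j. det (\<gamma> j) = 1"
    and lim: "(\<lambda>j. h_mat (s j) ** g ** \<gamma> j) \<longlonglongrightarrow> g'" and g': "det g' = 1"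
    and v: "inj_on v S" "independent (v ` S)" "\<And>i. i \<in> S \<Longrightarrow> v i \<in> int_vectors"
    and vW: "\<And>i j. i \<in> S \<Longrightarrow> v i v* \<gamma>' j \<in> W"
  shows False
proof -
  define W' where "W' = span (v ` S)"
  have W': "subspace W'" "dim W' = card S"
    using v(1,2) by (simp_all add: W'_def dim_eq_card_independent card_image)
  \<comment> \<open>Completing with standard basis vectors makes \<open>G\<close> integer valued on
    integral frames. On frames of \<open>W'\<close> it is the volume up to a fixed nonzero
    factor.\<close>
  obtain \<tau>0 where \<tau>0: "det (\<chi> i. if i \<in> S then v i else mat 1 $ \<tau>0 i) \<noteq> 0"
    using det_frame_exists[of "mat 1" v S] v by auto
  define G where "G w = det (\<chi> i. if i \<in> S then w i else mat 1 $ \<tau>0 i)" for w :: "'m + 'n \<Rightarrow> real^('m + 'n)"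
  define P where "P w \<longleftrightarrow> (\<forall>i\<in>S. w i \<in> int_vectors \<and> w i \<in> W') \<and> G w \<noteq> 0" for w
  have GZ: "G w \<in> \<int>" if "P w" for w
    unfolding G_def
  proof (rule det_integral_matrix)
    show "integral_matrix (\<chi> i. if i \<in> S then w i else mat 1 $ \<tau>0 i)"
      using that by (auto simp: P_def integral_matrix_def int_vectors_def mat_def)
  qed
  have "P v" using v(3) \<tau>0 by (auto simp: P_def W'_def G_def span_base)
  then obtain w where w: "P w" and wmin: "\<And>w'. P w' \<Longrightarrow> nat \<lfloor>\<bar>G w\<bar>\<rfloor> \<le> nat \<lfloor>\<bar>G w'\<bar>\<rfloor>"
    using ex_has_least_nat[of P v "\<lambda>w. nat \<lfloor>\<bar>G w\<bar>\<rfloor>"] by blast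
  have wmin': "\<bar>G w\<bar> \<le> \<bar>G w'\<bar>" if "P w'" for w'
  proof -
    obtain a b where ab: "G w = of_int a" "G w' = of_int b"
      using GZ[OF \<open>P w'\<close>] GZ[OF w] by (metis Ints_cases)
    have "nat \<bar>a\<bar> \<le> nat \<bar>b\<bar>"
      using wmin[OF that] unfolding ab of_int_abs[symmetric] floor_of_int .
    then show ?thesis unfolding ab of_int_abs[symmetric] of_int_le_iff by linarith
  qed
  have wi: "inj_on w S" "independent (w ` S)"
    using det_frame_independent[of S w] w unfolding P_def G_def by auto
  have wspan: "span (w ` S) = W'"
  proof (rule subspace_dim_equal)
    show "span (w ` S) \<subseteq> W'" using w W' by (intro span_minimal) (auto simp: P_def)
    show "dim W' \<le> dim (span (w ` S))" using W' wi by (simp add: dim_eq_card_independent card_image)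
  qed (use W' in auto)
  have W'W: "x v* \<gamma>' j \<in> W" if "x \<in> W'" for x j
  proof -
    have "subspace {x. x v* \<gamma>' j \<in> W}"
      using linear_subspace_vimage[OF linear_vmult[of "\<gamma>' j"] W(1)] by (simp add: vimage_def)
    then have "W' \<subseteq> {x. x v* \<gamma>' j \<in> W}" unfolding W'_def using vW by (intro span_minimal) auto
    then show ?thesis using that by blast
  qed
  have inj\<gamma>': "inj (\<lambda>x. x v* \<gamma>' j)" for j
    by (rule inj_on_inverseI[of _ "\<lambda>x. x v* \<gamma> j"]) (simp add: vector_matrix_mul_assoc \<gamma>)
  have inj\<gamma>: "inj (\<lambda>x. x v* \<gamma> j)" for j
    by (rule inj_on_inverseI[of _ "\<lambda>x. x v* \<gamma>' j"]) (simp add: vector_matrix_mul_assoc \<gamma>)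
  \<comment> \<open>Injectivity and equal dimensions upgrade the inclusion \<open>W'W\<close> to an
    equality, so \<gamma> j carries all of \<open>W\<close> back into \<open>W'\<close>. Hence
    \<open>\<gamma>' j\<close> followed by \<gamma> j' preserves \<open>W'\<close> even for
    different indices.\<close>
  have WW': "x v* \<gamma> j \<in> W'" if "x \<in> W" for x j
  proof -
    have "(\<lambda>x. x v* \<gamma>' j) ` W' = W"
    proof (rule subspace_dim_equal)
      show "subspace ((\<lambda>x. x v* \<gamma>' j) ` W')" by (rule linear_subspace_image[OF linear_vmult W'(1)])
      have "dim ((\<lambda>x. x v* \<gamma>' j) ` W') = dim W'"
        by (rule dim_image_eq[OF linear_vmult]) (rule inj_on_subset[OF inj\<gamma>' subset_UNIV])
      then show "dim W \<le> dim ((\<lambda>x. x v* \<gamma>' j) ` W')" using W W' by simp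
    qed (use W'W W in auto)
    then have "x \<in> (\<lambda>x. x v* \<gamma>' j) ` W'" using \<open>x \<in> W\<close> by (rule ssubst)
    then obtain y where "y \<in> W'" "x = y v* \<gamma>' j" by (rule imageE)
    then show ?thesis by (simp add: vector_matrix_mul_assoc \<gamma>)
  qed
  \<comment> \<open>Completing with rows of the limit matrix selects a Pluecker coordinate that
    stays away from 0 in the limit.\<close>
  obtain \<tau> where \<tau>: "inj_on \<tau> (- S)" "det (\<chi> i. if i \<in> S then w i else g' $ \<tau> i) \<noteq> 0"
    using det_frame_exists[of g' w S] g' wi by auto
  define E where "E j = det (\<chi> i. if i \<in> S then w i else (g ** \<gamma> j) $ \<tau> i)" for j
  \<comment> \<open>The transported frame \<open>?u\<close> is again integral in \<open>W'\<close>,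
    so minimality of \<open>w\<close> gives |D| \<ge> 1, while \<open>E j = D * E j'\<close>.
    Exchanging the two indices shows that |E| is constant.\<close>
  have Ele: "\<bar>E j'\<bar> \<le> \<bar>E j\<bar>" for j j'
  proof -
    let ?u = "\<lambda>i. w i v* \<gamma>' j v* \<gamma> j'"
    have uW: "?u i \<in> W'" if "i \<in> S" for i using w that W'W WW' by (auto simp: P_def)
    have ui: "?u i \<in> int_vectors" if "i \<in> S" for i
      using w that by (intro int_vectors_vmult \<gamma>) (auto simp: P_def)
    obtain D where D: "\<And>a. det (\<chi> i. if i \<in> S then ?u i else a i) = D * det (\<chi> i. if i \<in> S then w i else a i)"
      using det_frame_change_of_basis[OF wi(1), of ?u] uW wspan by auto
    \<comment> \<open>The frame \<open>?u\<close> is still independent, so some completion of it has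
      nonzero determinant.\<close>
    have "D \<noteq> 0"
    proof
      assume "D = 0"
      have lin: "linear (\<lambda>x. x v* \<gamma>' j v* \<gamma> j')" by (simp add: vector_matrix_mul_assoc linear_vmult)
      have inj: "inj (\<lambda>x. x v* \<gamma>' j v* \<gamma> j')"
        using inj_compose[OF inj\<gamma>[of j'] inj\<gamma>'[of j]] by (simp add: o_def)
      have "inj_on ?u S" using wi(1) inj by (auto simp: inj_on_def)
      moreover have "independent (?u ` S)"
        using linear_independent_injective_image[OF lin wi(2)] inj by (simp add: image_image inj_on_subset)
      ultimately show False
        using det_frame_exists[of "mat 1" ?u S] D \<open>D = 0\<close> by auto
    qed
    have "G ?u = D * G w" using D by (simp add: G_def)
    moreover from this have "P ?u" using uW ui \<open>D \<noteq> 0\<close> w by (auto simp: P_def)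
    ultimately have "\<bar>G w\<bar> \<le> \<bar>D\<bar> * \<bar>G w\<bar>" using wmin' by (metis abs_mult)
    then have D1: "1 \<le> \<bar>D\<bar>" using w by (simp add: P_def)
    have eq: "E j = det (\<chi> i. if i \<in> S then w i v* \<gamma>' j else g $ \<tau> i)" for j
    proof -
      have "(\<chi> i. if i \<in> S then w i v* \<gamma>' j else g $ \<tau> i) ** \<gamma> j = (\<chi> i. if i \<in> S then w i else (g ** \<gamma> j) $ \<tau> i)"
        by (simp add: frame_matrix_mult vector_matrix_mul_assoc \<gamma> row_mult cong: if_cong)
      then show ?thesis
        unfolding E_def using det_mul[of "\<chi> i. if i \<in> S then w i v* \<gamma>' j else g $ \<tau> i" "\<gamma> j"] \<gamma>(5) by simp
    qed
    have "(\<chi> i. if i \<in> S then w i v* \<gamma>' j else g $ \<tau> i) ** \<gamma> j' = (\<chi> i. if i \<in> S then ?u i else (g ** \<gamma> j') $ \<tau> i)"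
      by (simp add: frame_matrix_mult row_mult cong: if_cong)
    then have "E j = det (\<chi> i. if i \<in> S then ?u i else (g ** \<gamma> j') $ \<tau> i)"
      unfolding eq using det_mul[of "\<chi> i. if i \<in> S then w i v* \<gamma>' j else g $ \<tau> i" "\<gamma> j'"] \<gamma>(5) by simp
    also have "\<dots> = D * E j'" unfolding D E_def ..
    finally show ?thesis using D1 by (simp add: abs_mult mult_le_cancel_right1)
  qed
  have Econst: "\<bar>E j\<bar> = \<bar>E 0\<bar>" for j using Ele[of 0 j] Ele[of j 0] by simp
  define c where "c = real CARD('n) * real (card (Inl -` (\<tau> ` (- S)) :: 'm set)) - real CARD('m) * real (card (Inr -` (\<tau> ` (- S)) :: 'n set))"
  have c: "c \<noteq> 0" unfolding c_def
  proof (rule coprime_weight_nonzero[OF cop])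
    show "\<tau> ` (- S) \<noteq> {}" using S by auto
    have "card (\<tau> ` (- S)) < CARD('m + 'n)"
      unfolding card_image[OF \<tau>(1)] using S(1) by (intro psubset_card_mono) auto
    then show "\<tau> ` (- S) \<noteq> UNIV" by auto
  qed
  define L where "L = det (\<chi> i. if i \<in> S then w i else g' $ \<tau> i)"
  have "continuous_on UNIV (\<lambda>M. det (\<chi> i. if i \<in> S then w i else M $ \<tau> i))"
  proof (intro continuous_on_det continuous_on_vec_lambda)
    fix i show "continuous_on UNIV (\<lambda>M. if i \<in> S then w i else M $ \<tau> i)"
      by (cases "i \<in> S") (auto intro!: continuous_intros)
  qed
  then have "(\<lambda>j. det (\<chi> i. if i \<in> S then w i else (h_mat (s j) ** g ** \<gamma> j) $ \<tau> i)) \<longlonglongrightarrow> L"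
    unfolding L_def by (rule continuous_on_tendsto_compose[OF _ lim]) auto
  moreover have "det (\<chi> i. if i \<in> S then w i else (h_mat (s j) ** g ** \<gamma> j) $ \<tau> i) = exp (s j * c) * E j" for j
    unfolding matrix_mul_assoc[symmetric] det_frame_h_mat[OF \<tau>(1)] E_def prod_h_diag c_def by simp
  ultimately have "(\<lambda>j. exp (s j * c) * E j) \<longlonglongrightarrow> L" by simp
  then have "(\<lambda>j. \<bar>exp (s j * c) * E j\<bar>) \<longlonglongrightarrow> \<bar>L\<bar>" by (rule tendsto_rabs)
  note limE = this
  have lim1: "(\<lambda>j. exp (s j * c) * \<bar>E 0\<bar>) \<longlonglongrightarrow> \<bar>L\<bar>" 
  proof -
    have "\<bar>exp (s j * c) * E j\<bar> = exp (s j * c) * \<bar>E 0\<bar>" for j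
      unfolding abs_mult Econst[of j] by simp
    then show ?thesis using limE by simp
  qed
  have L: "L \<noteq> 0" using \<tau>(2) by (simp add: L_def)
  have E0: "E 0 \<noteq> 0"
  proof
    assume "E 0 = 0"
    then show False using lim1 L LIMSEQ_unique[of "\<lambda>_. 0" 0 "\<bar>L\<bar>"] by simp
  qed
  \<comment> \<open>With |E| constant and \<open>c\<close> nonzero, logarithms recover
    \<open>s\<close> itself as a convergent sequence, which contradicts its divergence.\<close>
  have "(\<lambda>j. ln (exp (s j * c) * \<bar>E 0\<bar> / \<bar>E 0\<bar>) / c) \<longlonglongrightarrow> ln (\<bar>L\<bar> / \<bar>E 0\<bar>) / c"
    using L E0 c by (intro tendsto_intros lim1) auto
  then have "s \<longlonglongrightarrow> ln (\<bar>L\<bar> / \<bar>E 0\<bar>) / c" using E0 c by simp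
  then show False
    using not_tendsto_and_filterlim_at_infinity[OF sequentially_bot] filterlim_at_top_imp_at_infinity[OF s]
    by blast
qed

subsection \<open>Iterated accumulation points\<close>

text \<open>Along \<open>h\<^sub>T x \<rightarrow> lattice_of g\<close> with \<open>T \<rightarrow> \<infinity>\<close>, all integral characters outside \<open>W\<close> oscillate faster and
  faster in the direction \<open>h\<^sub>T p\<close>. Testing finitely many characters at a time avoids choosing a
  diagonal sequence.\<close>

definition reachable ::
    "(real^('m::finite + 'n::finite)) set \<Rightarrow> real^('m + 'n) \<Rightarrow> real^('m + 'n)^('m + 'n) \<Rightarrow> (real^('m + 'n)) set \<Rightarrow> bool" where
  "reachable x p g W \<longleftrightarrow> (\<forall>F R e. finite F \<longrightarrow> F \<subseteq> int_vectors - W \<longrightarrow> 0 < e \<longrightarrow>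
     (\<exists>T g' z. R \<le> T \<and> det g' = 1 \<and> dist g' g < e \<and> lattice_of g' = (\<lambda>v. h_mat T *v v) ` x \<and>
       g' *v z = h_mat T *v p \<and> (\<forall>\<xi>\<in>F. R \<le> \<bar>\<xi> \<bullet> z\<bar>)))"

lemma reachableE:
  assumes "reachable x p g W" "finite F" "F \<subseteq> int_vectors - W" "0 < e"
  obtains T g' z where "R \<le> T" "det g' = 1" "dist g' g < e" "lattice_of g' = (\<lambda>v. h_mat T *v v) ` x"
    "g' *v z = h_mat T *v p" "\<And>\<xi>. \<xi> \<in> F \<Longrightarrow> R \<le> \<bar>\<xi> \<bullet> z\<bar>"
  using assms unfolding reachable_def by meson

text \<open>The vector \<open>p\<close> lies in the expanding factor, so the direction in the
  coordinates of \<open>g'\<close> is exp(nT) times a vector close to \<open>q\<close>. Every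
  character with nonzero value at \<open>q\<close> therefore blows up, and only those orthogonal to
  \<open>q\<close> remain.\<close>

lemma reachable_first_step:
  fixes x :: "(real^('m::finite + 'n::finite)) set" and p q :: "real^('m + 'n)"
  assumes y: "lattice_of g \<in> boundary_set x" and g: "det g = 1"
    and p: "\<And>j. p $ Inr j = 0" and q: "g *v q = p"
  shows "reachable x p g {\<xi>. q \<bullet> \<xi> = 0}"
  unfolding reachable_def
proof (intro allI impI)
  fix F :: "(real^('m + 'n)) set" and R e :: real
  assume F: "finite F" "F \<subseteq> int_vectors - {\<xi>. q \<bullet> \<xi> = 0}" and e: "0 < e"
  \<comment> \<open>Cramer's rule, which makes the continuous dependence on the matrix visible.\<close>
  define zc :: "real^('m + 'n)^('m + 'n) \<Rightarrow> real^('m + 'n)" where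
    "zc M = (\<chi> k. det (\<chi> i j. if j = k then p $ i else M $ i $ j))" for M
  have zc: "M *v zc M = p" if "det M = 1" for M
    using cramer[of M "zc M" p] that by (simp add: zc_def)
  have zcg: "zc g = q" using cramer[of g q p] g q by (simp add: zc_def)
  have cont: "continuous_on UNIV zc"
    unfolding zc_def
  proof (intro continuous_on_vec_lambda continuous_on_det)
    fix k i j show "continuous_on UNIV (\<lambda>M. if j = k then p $ i else M $ i $ j)"
      by (cases "j = k") (auto intro!: continuous_intros)
  qed
  \<comment> \<open>Half of the values at \<open>q\<close> is used so that the lower bound survives
    a small change of the matrix.\<close>
  have "\<exists>c>0. \<forall>\<xi>\<in>F. c \<le> \<bar>\<xi> \<bullet> q\<bar> / 2"
    using F
  proof (induction F rule: finite_induct)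
    case empty
    then show ?case by (auto intro: exI[of _ 1])
  next
    case (insert \<xi> F)
    then obtain c where c: "c > 0" "\<forall>\<xi>\<in>F. c \<le> \<bar>\<xi> \<bullet> q\<bar> / 2" by auto
    have "\<bar>\<xi> \<bullet> q\<bar> > 0" using insert.prems by (auto simp: inner_commute)
    then show ?case using c by (intro exI[of _ "min c (\<bar>\<xi> \<bullet> q\<bar> / 2)"]) auto
  qed
  then obtain c where c: "c > 0" "\<And>\<xi>. \<xi> \<in> F \<Longrightarrow> c \<le> \<bar>\<xi> \<bullet> q\<bar> / 2" by blast
  have "\<forall>\<^sub>F M in nhds g. c \<le> \<bar>\<xi> \<bullet> zc M\<bar>" if "\<xi> \<in> F" for \<xi>
  proof -
    have "continuous_on UNIV (\<lambda>M. \<bar>\<xi> \<bullet> zc M\<bar>)" by (intro continuous_intros cont)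
    then have "open {M. c < \<bar>\<xi> \<bullet> zc M\<bar>}" by (intro open_Collect_less continuous_on_const)
    moreover have "g \<in> {M. c < \<bar>\<xi> \<bullet> zc M\<bar>}" using c(1) c(2)[OF that] by (simp add: zcg)
    ultimately have "\<forall>\<^sub>F M in nhds g. M \<in> {M. c < \<bar>\<xi> \<bullet> zc M\<bar>}" by (rule eventually_nhds_in_open)
    then show ?thesis by (rule eventually_mono) simp
  qed
  then have "\<forall>\<^sub>F M in nhds g. \<forall>\<xi>\<in>F. c \<le> \<bar>\<xi> \<bullet> zc M\<bar>"
    using F(1) by (intro eventually_ball_finite) auto
  then obtain d where d: "d > 0" "\<And>M. dist M g < d \<Longrightarrow> \<forall>\<xi>\<in>F. c \<le> \<bar>\<xi> \<bullet> zc M\<bar>"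
    unfolding eventually_nhds_metric by blast
  \<comment> \<open>The bound |R| / c on the time is enough because exp(nT) \<ge> T.\<close>
  obtain T g' where T: "T \<ge> max R (\<bar>R\<bar> / c)" and g': "det g' = 1" "dist g' g < min d e"
    "lattice_of g' = (\<lambda>v. h_mat T *v v) ` x"
    using boundary_set_approx[OF y g, of "min d e" "max R (\<bar>R\<bar> / c)"] d(1) e by auto
  have T0: "T \<ge> 0" "T \<ge> R" "c * T \<ge> R"
  proof -
    show "T \<ge> R" using T by simp
    have "T \<ge> \<bar>R\<bar> / c" using T by simp
    then show "T \<ge> 0" "c * T \<ge> R" using c(1) by (auto simp: field_simps intro: order_trans[of 0 "\<bar>R\<bar> / c"])
  qed
  define E where "E = exp (real CARD('n) * T)"
  have "T \<le> real CARD('n) * T" using T0 by (simp add: mult_le_cancel_right1 Suc_leI)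
  then have E: "E \<ge> T" unfolding E_def using exp_ge_add_one_self[of "real CARD('n) * T"] by linarith
  have "g' *v (E *\<^sub>R zc g') = h_mat T *v p"
  proof -
    have "h_mat T *v p = E *\<^sub>R p"
      using p by (auto simp: vec_eq_iff h_mat_mult_vec h_diag_def E_def split: sum.splits)
    then show ?thesis by (simp add: matrix_vector_mult_scaleR zc g')
  qed
  moreover have "R \<le> \<bar>\<xi> \<bullet> (E *\<^sub>R zc g')\<bar>" if "\<xi> \<in> F" for \<xi>
  proof -
    have "R \<le> T * c" using T0 by (simp add: mult.commute)
    also have "\<dots> \<le> E * \<bar>\<xi> \<bullet> zc g'\<bar>"
      using d(2)[of g'] g' that E T0 c(1) by (intro mult_mono) auto
    also have "\<dots> = \<bar>\<xi> \<bullet> (E *\<^sub>R zc g')\<bar>" by (simp add: abs_mult E_def)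
    finally show ?thesis .
  qed
  ultimately show "\<exists>T g' z. R \<le> T \<and> det g' = 1 \<and> dist g' g < e \<and> lattice_of g' = (\<lambda>v. h_mat T *v v) ` x \<and>
       g' *v z = h_mat T *v p \<and> (\<forall>\<xi>\<in>F. R \<le> \<bar>\<xi> \<bullet> z\<bar>)"
    using T0 g' by (intro exI[of _ T] exI[of _ g'] exI[of _ "E *\<^sub>R zc g'"]) auto
qed

text \<open>In the new basis a character \<xi> becomes \<open>\<xi> v* \<gamma>' j\<close> in the
  old one, and it is harmless when that vector avoids \<open>W\<close>. By
  \<open>no_persistent_subspace\<close>, a full set of \<open>dim W\<close> independent characters
  cannot return to \<open>W\<close> infinitely often, so the span of those that do has smaller
  dimension.\<close>

lemma reachable_step:
  fixes x :: "(real^('m::finite + 'n::finite)) set" and p :: "real^('m + 'n)"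
  assumes cop: "coprime CARD('m) CARD('n)" and r: "reachable x p g W" and g: "det g = 1"
    and W: "subspace W" "dim W < CARD('m) + CARD('n)"
    and g1: "det g1 = 1" "lattice_of g1 \<in> boundary_set (lattice_of g)"
  obtains W' where "subspace W'" "dim W' \<le> dim W - 1" "reachable x p g1 W'"
proof -
  have "\<exists>t \<gamma> \<gamma>'. t \<ge> real j \<and> integral_matrix \<gamma> \<and> integral_matrix \<gamma>' \<and> \<gamma> ** \<gamma>' = mat 1 \<and> \<gamma>' ** \<gamma> = mat 1 \<and>
      det \<gamma> = 1 \<and> dist (h_mat t ** g ** \<gamma>) g1 < 1 / real (Suc j)" for j
  proof -
    obtain t g' where t: "t \<ge> real j" "det g' = 1" "dist g' g1 < 1 / real (Suc j)"
      "lattice_of g' = (\<lambda>v. h_mat t *v v) ` lattice_of g"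
      using boundary_set_approx[OF g1(2,1), of "1 / real (Suc j)" "real j"] by auto
    have d: "det (h_mat t ** g) = 1" by (simp add: det_mul det_h_mat g)
    have l: "lattice_of (h_mat t ** g) = lattice_of g'" using t(4) by (simp add: image_lattice_of)
    obtain \<gamma> \<gamma>' where "integral_matrix \<gamma>" "integral_matrix \<gamma>'" "\<gamma> ** \<gamma>' = mat 1" "\<gamma>' ** \<gamma> = mat 1"
      "det \<gamma> = 1" "g' = h_mat t ** g ** \<gamma>"
      by (rule lattice_of_eqE[OF d t(2) l])
    then show ?thesis using t by blast
  qed
  then obtain s \<gamma> \<gamma>' where s: "\<And>j. s j \<ge> real j"
    and \<gamma>: "\<And>j. integral_matrix (\<gamma> j)" "\<And>j. integral_matrix (\<gamma>' j)" "\<And>j. \<gamma> j ** \<gamma>' j = mat 1"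
      "\<And>j. \<gamma>' j ** \<gamma> j = mat 1" "\<And>j. det (\<gamma> j) = 1"
    and near: "\<And>j. dist (h_mat (s j) ** g ** \<gamma> j) g1 < 1 / real (Suc j)"
    by metis
  have lim: "(\<lambda>j. h_mat (s j) ** g ** \<gamma> j) \<longlonglongrightarrow> g1"
  proof (rule metric_tendsto_imp_tendsto[OF LIMSEQ_inverse_real_of_nat], rule always_eventually, rule allI)
    fix j show "dist (h_mat (s j) ** g ** \<gamma> j) g1 \<le> dist (inverse (real (Suc j))) 0"
      using near[of j] by (simp add: inverse_eq_divide dist_norm)
  qed
  have slim: "filterlim s at_top sequentially"
    by (rule filterlim_at_top_mono[OF filterlim_real_sequentially]) (use s in auto)
  \<comment> \<open>A maximal \<open>Z\<close> with infinite \<open>J Z\<close> spans the new subspace: every other integral vector leaves it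
    for almost all \<open>j \<in> J Z\<close>.\<close>
  define J where "J Z = {j. \<forall>\<xi>\<in>Z. \<xi> v* \<gamma>' j \<in> W}" for Z
  define Q where "Q Z \<longleftrightarrow> Z \<subseteq> int_vectors \<and> independent Z \<and> infinite (J Z)" for Z
  have inj: "inj (\<lambda>x. x v* \<gamma>' j)" for j
    by (rule inj_on_inverseI[of _ "\<lambda>x. x v* \<gamma> j"]) (simp add: vector_matrix_mul_assoc \<gamma>)
  have Qle: "card Z \<le> dim W" if QZ: "Q Z" for Z
  proof -
    have "J Z \<noteq> {}" using QZ unfolding Q_def by auto
    then obtain j where j: "j \<in> J Z" by blast
    have "independent ((\<lambda>x. x v* \<gamma>' j) ` Z)"
      using QZ inj[of j] linear_independent_injective_image[OF linear_vmult[of "\<gamma>' j"]]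
      by (auto simp: Q_def intro: inj_on_subset)
    moreover have "(\<lambda>x. x v* \<gamma>' j) ` Z \<subseteq> W" using j by (auto simp: J_def)
    ultimately have "card ((\<lambda>x. x v* \<gamma>' j) ` Z) \<le> dim W" by (metis independent_card_le_dim)
    then show ?thesis using inj[of j] by (simp add: card_image inj_on_subset)
  qed
  have Qne: "card Z \<noteq> dim W" if Z: "Q Z" "Z \<noteq> {}" for Z
  proof
    assume cZ: "card Z = dim W"
    have finZ: "finite Z" using Z(1) independent_bound unfolding Q_def by blast
    \<comment> \<open>Frames are matrices with rows indexed by coordinates, so \<open>Z\<close> is
      enumerated by a set of coordinates of the same size; it is proper because \<open>W\<close>
      is.\<close>
    obtain S :: "('m + 'n) set" where S: "card S = card Z"
      using obtain_subset_with_card_n[of "card Z" "UNIV :: ('m + 'n) set"] cZ W(2)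
      by (auto simp: card_UNIV_sum)
    obtain v where v: "bij_betw v S Z"
      using finite_same_card_bij[of S Z] S finZ by auto
    have vi: "inj_on v S" "v ` S = Z" using v by (auto simp: bij_betw_def)
    obtain r :: "nat \<Rightarrow> nat" where r: "strict_mono r" "\<And>n. r n \<in> J Z"
      using infinite_enumerate Z(1) unfolding Q_def by blast
    show False
    proof (rule no_persistent_subspace[where S = S and W = W and s = "s \<circ> r" and \<gamma> = "\<gamma> \<circ> r" and \<gamma>' = "\<gamma>' \<circ> r"
          and g = g and g' = g1 and v = v, OF cop])
      show "S \<noteq> {}" using vi Z(2) by auto
      show "S \<noteq> UNIV" using S cZ W(2) by (auto simp: card_UNIV_sum)
      show "filterlim (s \<circ> r) at_top sequentially"
        unfolding o_def using filterlim_compose[OF slim filterlim_subseq[OF r(1)]] .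
      show "(\<lambda>j. h_mat ((s \<circ> r) j) ** g ** (\<gamma> \<circ> r) j) \<longlonglongrightarrow> g1"
        using LIMSEQ_subseq_LIMSEQ[OF lim r(1)] by (simp add: o_def)
      show "v i v* (\<gamma>' \<circ> r) j \<in> W" if "i \<in> S" for i j
        using r(2)[of j] vi(2) that by (auto simp: J_def)
    qed (use W \<gamma> g1 vi Z(1) S cZ in \<open>auto simp: Q_def\<close>)
  qed
  have "Q {}" by (auto simp: Q_def J_def independent_empty)
  then obtain Z where Z: "Q Z" and Zmax: "\<And>Y. Q Y \<Longrightarrow> card Y \<le> card Z"
    using ex_has_greatest_nat[of Q "{}" card "Suc (dim W)"] Qle by (auto simp: less_Suc_eq_le)
  have finZ: "finite Z" using Z independent_bound unfolding Q_def by blast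
  show ?thesis
  proof (rule that[of "span Z"])
    show "subspace (span Z)" by simp
    have "dim (span Z) = card Z" using Z by (simp add: Q_def dim_eq_card_independent)
    \<comment> \<open>If \<open>dim W\<close> is 0 then \<open>Z\<close> is empty, which the
      truncated subtraction permits.\<close>
    then show "dim (span Z) \<le> dim W - 1"
      using Qle[OF Z] Qne[OF Z] by (cases "Z = {}") auto
    show "reachable x p g1 (span Z)"
      unfolding reachable_def
    proof (intro allI impI)
      fix F :: "(real^('m + 'n)) set" and R e :: real
      assume F: "finite F" "F \<subseteq> int_vectors - span Z" and e: "0 < e"
      have fin: "finite (J (insert \<xi> Z))" if "\<xi> \<in> F" for \<xi>
      proof (rule ccontr)
        assume inf: "infinite (J (insert \<xi> Z))"
        have \<xi>: "\<xi> \<in> int_vectors" "\<xi> \<notin> span Z" using F that by auto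
        then have "\<xi> \<notin> Z" using span_base by blast
        have "Q (insert \<xi> Z)" using Z \<xi> inf by (auto simp: Q_def independent_insert)
        then have "card (insert \<xi> Z) \<le> card Z" by (rule Zmax)
        then show False using \<open>\<xi> \<notin> Z\<close> finZ by simp
      qed
      have "infinite (J Z - (\<Union>\<xi>\<in>F. J (insert \<xi> Z)))"
        using Z fin F(1) by (intro Diff_infinite_finite) (auto simp: Q_def)
      then obtain j where j: "j \<ge> nat \<lceil>max R (2 / e)\<rceil>" "j \<in> J Z - (\<Union>\<xi>\<in>F. J (insert \<xi> Z))"
        unfolding infinite_nat_iff_unbounded_le by blast
      have jR: "real j \<ge> R" "real j \<ge> 2 / e" using j(1) by linarith+
      have "1 / real (Suc j) \<le> e / 2"
        using jR(2) e by (simp add: field_simps)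
      with near[of j] have near2: "dist (h_mat (s j) ** g ** \<gamma> j) g1 < e / 2" by linarith
      have F': "\<xi> v* \<gamma>' j \<in> int_vectors - W" if "\<xi> \<in> F" for \<xi>
        using that F(2) j(2) \<gamma>(2) int_vectors_vmult by (auto simp: J_def)
      \<comment> \<open>The index \<open>j\<close> is fixed first; only then is \<open>g\<close>
        approximated finely enough to survive the flow by \<open>s j\<close> and the change of
        basis. The two times add up.\<close>
      have "continuous_on UNIV (\<lambda>M. h_mat (s j) ** M ** \<gamma> j)" by (intro continuous_intros)
      then obtain d where d: "d > 0" "\<And>M. dist M g < d \<Longrightarrow> dist (h_mat (s j) ** M ** \<gamma> j) (h_mat (s j) ** g ** \<gamma> j) < e / 2"
        using e unfolding continuous_on_iff by (metis UNIV_I half_gt_zero)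
      obtain T g' z where T: "max R 0 \<le> T" "det g' = 1" "dist g' g < d" "lattice_of g' = (\<lambda>v. h_mat T *v v) ` x"
        "g' *v z = h_mat T *v p" "\<And>\<xi>. \<xi> \<in> (\<lambda>\<xi>. \<xi> v* \<gamma>' j) ` F \<Longrightarrow> max R 0 \<le> \<bar>\<xi> \<bullet> z\<bar>"
        by (rule reachableE[OF r, of "(\<lambda>\<xi>. \<xi> v* \<gamma>' j) ` F" d "max R 0"]) (use F(1) F' d(1) in auto)
      let ?g = "h_mat (s j) ** g' ** \<gamma> j"
      have "R \<le> s j + T" using T(1) s[of j] jR(1) by linarith
      moreover have "det ?g = 1" by (simp add: det_mul det_h_mat \<gamma> T)
      moreover have "dist ?g g1 < e"
        using near2 d(2)[OF T(3)] dist_triangle[of ?g g1 "h_mat (s j) ** g ** \<gamma> j"] by linarith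
      moreover have "lattice_of ?g = (\<lambda>v. h_mat (s j + T) *v v) ` x"
        unfolding lattice_of_mult_integral[OF \<gamma>(1-3)] image_lattice_of[symmetric, of "h_mat (s j)" g'] T(4)
        by (simp add: image_image matrix_vector_mul_assoc h_mat_add)
      moreover have "?g *v (\<gamma>' j *v z) = h_mat (s j + T) *v p"
      proof -
        have "?g *v (\<gamma>' j *v z) = (h_mat (s j) ** g' ** (\<gamma> j ** \<gamma>' j)) *v z"
          by (simp add: matrix_vector_mul_assoc matrix_mul_assoc)
        also have "\<dots> = h_mat (s j) *v (g' *v z)" by (simp add: \<gamma> matrix_vector_mul_assoc)
        also have "\<dots> = h_mat (s j + T) *v p" by (simp add: T(5) matrix_vector_mul_assoc h_mat_add)
        finally show ?thesis .
      qed
      moreover have "\<forall>\<xi>\<in>F. R \<le> \<bar>\<xi> \<bullet> (\<gamma>' j *v z)\<bar>"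
        using T(6) by (auto simp: dot_lmul_matrix[symmetric])
      ultimately show "\<exists>T g' z. R \<le> T \<and> det g' = 1 \<and> dist g' g1 < e \<and> lattice_of g' = (\<lambda>v. h_mat T *v v) ` x \<and>
       g' *v z = h_mat T *v p \<and> (\<forall>\<xi>\<in>F. R \<le> \<bar>\<xi> \<bullet> z\<bar>)" by blast
    qed
  qed
qed

subsection \<open>Coordinates and norms\<close>

definition vfst :: "real^('m::finite + 'n::finite) \<Rightarrow> real^'m" where "vfst x = (\<chi> i. x $ Inl i)"
definition vsnd :: "real^('m::finite + 'n::finite) \<Rightarrow> real^'n" where "vsnd x = (\<chi> j. x $ Inr j)"
definition vinl :: "real^'m \<Rightarrow> real^('m::finite + 'n::finite)" where
  "vinl p = (\<chi> k. case k of Inl i \<Rightarrow> p $ i | Inr j \<Rightarrow> 0)"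

lemma vfst_simps [simp]:
  "vfst (x + y) = vfst x + vfst y" "vfst (x - y) = vfst x - vfst y" "vfst (c *\<^sub>R x) = c *\<^sub>R vfst x" "vfst (vinl p) = p"
  by (simp_all add: vfst_def vinl_def vec_eq_iff)

lemma vsnd_simps [simp]:
  "vsnd (x + y) = vsnd x + vsnd y" "vsnd (x - y) = vsnd x - vsnd y" "vsnd (c *\<^sub>R x) = c *\<^sub>R vsnd x" "vsnd (vinl p) = 0"
  by (simp_all add: vsnd_def vinl_def vec_eq_iff)

lemma vfst_axis [simp]: "vfst (axis (Inl i) 1) = axis i 1" "vfst (axis (Inr j) 1) = 0"
  by (auto simp: vfst_def axis_def vec_eq_iff)

lemma vsnd_axis [simp]: "vsnd (axis (Inl i) 1) = 0" "vsnd (axis (Inr j) 1) = axis j 1"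
  by (auto simp: vsnd_def axis_def vec_eq_iff)

lemma vinl_scaleR_add: "vinl (t *\<^sub>R p + q) = t *\<^sub>R vinl p + vinl q"
  by (auto simp: vinl_def vec_eq_iff split: sum.splits)

lemma vfst_h_mat:
  "vfst (h_mat T *v (x :: real^('m::finite + 'n::finite))) = exp (real CARD('n) * T) *\<^sub>R vfst x"
  by (simp add: vfst_def vec_eq_iff h_mat_mult_vec h_diag_def)

lemma vsnd_h_mat:
  "vsnd (h_mat T *v (x :: real^('m::finite + 'n::finite))) = exp (- real CARD('m) * T) *\<^sub>R vsnd x"
  by (simp add: vsnd_def vec_eq_iff h_mat_mult_vec h_diag_def)

lemma sum_UNIV_Plus:
  "(\<Sum>k\<in>(UNIV :: ('a::finite + 'b::finite) set). f k) = (\<Sum>i\<in>UNIV. f (Inl i)) + (\<Sum>j\<in>UNIV. f (Inr j))"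
  by (simp add: UNIV_Plus_UNIV[symmetric] sum.Plus del: UNIV_Plus_UNIV)

lemma vfst_u_mat: "vfst (u_mat A *v x) = vfst x + A *v vsnd x"
  by (simp add: vec_eq_iff vfst_def vsnd_def u_mat_def matrix_vector_mult_def sum_UNIV_Plus
      if_distrib if_distribR sum.delta cong: if_cong)

lemma vsnd_u_mat: "vsnd (u_mat A *v x) = vsnd x"
  by (simp add: vec_eq_iff vsnd_def u_mat_def matrix_vector_mult_def sum_UNIV_Plus
      if_distrib if_distribR sum.delta cong: if_cong)

lemma int_vectors_vfst: "x \<in> int_vectors \<Longrightarrow> vfst x \<in> int_vectors"
  by (simp add: int_vectors_def vfst_def)

lemma int_vectors_vsnd: "x \<in> int_vectors \<Longrightarrow> vsnd x \<in> int_vectors"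
  by (simp add: int_vectors_def vsnd_def)

lemma continuous_on_vfst [continuous_intros]: "continuous_on S f \<Longrightarrow> continuous_on S (\<lambda>x. vfst (f x))"
  unfolding vfst_def by (intro continuous_intros)

lemma continuous_on_vsnd [continuous_intros]: "continuous_on S f \<Longrightarrow> continuous_on S (\<lambda>x. vsnd (f x))"
  unfolding vsnd_def by (intro continuous_intros)

lemma is_norm_nonneg: "is_norm N \<Longrightarrow> 0 \<le> N x"
  and is_norm_scaleR: "is_norm N \<Longrightarrow> N (c *\<^sub>R x) = \<bar>c\<bar> * N x"
  and is_norm_triangle: "is_norm N \<Longrightarrow> N (x + y) \<le> N x + N y"
  and is_norm_eq_0: "is_norm N \<Longrightarrow> N x = 0 \<longleftrightarrow> x = 0"
  unfolding is_norm_def by blast+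

lemma is_norm_pos: "is_norm N \<Longrightarrow> x \<noteq> 0 \<Longrightarrow> 0 < N x"
  using is_norm_nonneg is_norm_eq_0 by (metis less_eq_real_def)

text \<open>A norm is convex, and a finite convex function on a finite-dimensional space is
  continuous.\<close>

lemma is_norm_continuous:
  assumes "is_norm N" shows "continuous_on UNIV N"
proof (rule convex_on_continuous)
  show "convex_on UNIV N"
  proof (rule convex_onI)
    fix t :: real and x y assume "t > 0" "t < 1"
    then show "N ((1 - t) *\<^sub>R x + t *\<^sub>R y) \<le> (1 - t) * N x + t * N y"
      using is_norm_triangle[OF assms, of "(1 - t) *\<^sub>R x" "t *\<^sub>R y"] by (simp add: is_norm_scaleR[OF assms])
  qed simp
qed simp

lemma is_norm_continuous_on [continuous_intros]:
  "is_norm N \<Longrightarrow> continuous_on S f \<Longrightarrow> continuous_on S (\<lambda>x. N (f x))"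
  by (rule continuous_on_compose2[OF is_norm_continuous]) auto

text \<open>Either all nonzero characters can be made fast, or some finite set of nonzero characters
  obstructs this. In the second case every good approximation has a slow character from that set; it
  lies in \<open>W\<close>, so it is a nonzero multiple of \<open>L\<close>, and
  \<open>L \<bullet> z\<close> is bounded uniformly.\<close>

lemma reachable_tame:
  assumes r: "reachable x p g W" and W: "W \<subseteq> span {L}"
  obtains B where "0 \<le> B" "\<And>F R e. finite F \<Longrightarrow> F \<subseteq> int_vectors \<Longrightarrow> 0 < e \<Longrightarrow>
     \<exists>T g' z. R \<le> T \<and> det g' = 1 \<and> dist g' g < e \<and> lattice_of g' = (\<lambda>v. h_mat T *v v) ` x \<and>
       g' *v z = h_mat T *v p \<and>
       (\<forall>\<xi>\<in>F. R \<le> \<bar>\<xi> \<bullet> z\<bar> \<or> \<xi> = 0 \<or> (\<exists>c. \<xi> = c *\<^sub>R L) \<and> \<bar>L \<bullet> z\<bar> \<le> B)"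
proof (cases "reachable x p g {0}")
  case True
  show ?thesis
  proof (rule that[of 0])
    fix F :: "(real^('a + 'b)) set" and R e :: real
    assume F: "finite F" "F \<subseteq> int_vectors" "0 < e"
    obtain T g' z where "R \<le> T" "det g' = 1" "dist g' g < e" "lattice_of g' = (\<lambda>v. h_mat T *v v) ` x"
      "g' *v z = h_mat T *v p" "\<And>\<xi>. \<xi> \<in> F - {0} \<Longrightarrow> R \<le> \<bar>\<xi> \<bullet> z\<bar>"
      by (rule reachableE[OF True, of "F - {0}" e R]) (use F in auto)
    then show "\<exists>T g' z. R \<le> T \<and> det g' = 1 \<and> dist g' g < e \<and> lattice_of g' = (\<lambda>v. h_mat T *v v) ` x \<and>
       g' *v z = h_mat T *v p \<and>
       (\<forall>\<xi>\<in>F. R \<le> \<bar>\<xi> \<bullet> z\<bar> \<or> \<xi> = 0 \<or> (\<exists>c. \<xi> = c *\<^sub>R L) \<and> \<bar>L \<bullet> z\<bar> \<le> 0)" by blast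
  qed simp
next
  case False
  then obtain F0 R0 e0 where F0: "finite F0" "F0 \<subseteq> int_vectors - {0}" "0 < e0"
    and none: "\<And>T g' z. R0 \<le> T \<Longrightarrow> det g' = 1 \<Longrightarrow> dist g' g < e0 \<Longrightarrow> lattice_of g' = (\<lambda>v. h_mat T *v v) ` x \<Longrightarrow>
       g' *v z = h_mat T *v p \<Longrightarrow> \<exists>\<xi>\<in>F0. \<not> R0 \<le> \<bar>\<xi> \<bullet> z\<bar>"
    unfolding reachable_def by meson
  \<comment> \<open>The slow character may vary with the approximation, so the sum over
    \<open>F0\<close> dominates every possible bound.\<close>
  define B where "B = (\<Sum>\<xi>\<in>F0. \<bar>R0\<bar> * norm L / norm \<xi>)"
  show ?thesis
  proof (rule that[of B])
    show "0 \<le> B" unfolding B_def by (intro sum_nonneg) auto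
    fix F :: "(real^('a + 'b)) set" and R e :: real
    assume F: "finite F" "F \<subseteq> int_vectors" "0 < e"
    obtain T g' z where T: "max R R0 \<le> T" "det g' = 1" "dist g' g < min e e0" "lattice_of g' = (\<lambda>v. h_mat T *v v) ` x"
      "g' *v z = h_mat T *v p" "\<And>\<xi>. \<xi> \<in> (F \<union> F0) - W \<Longrightarrow> max R R0 \<le> \<bar>\<xi> \<bullet> z\<bar>"
      by (rule reachableE[OF r, of "(F \<union> F0) - W" "min e e0" "max R R0"]) (use F F0 in auto)
    obtain \<xi>1 where \<xi>1: "\<xi>1 \<in> F0" "\<bar>\<xi>1 \<bullet> z\<bar> < R0"
      using none[of T g' z] T by (auto simp: not_le)
    then have "\<xi>1 \<in> W" using T(6)[of \<xi>1] by fastforce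
    then obtain c where c: "\<xi>1 = c *\<^sub>R L" using W by (auto simp: span_singleton)
    have nz: "\<xi>1 \<noteq> 0" using \<xi>1 F0 by auto
    have "\<bar>L \<bullet> z\<bar> * norm \<xi>1 = norm L * \<bar>\<xi>1 \<bullet> z\<bar>" by (simp add: c abs_mult)
    also have "\<dots> \<le> norm L * \<bar>R0\<bar>" using \<xi>1 by (intro mult_left_mono) auto
    finally have "\<bar>L \<bullet> z\<bar> \<le> \<bar>R0\<bar> * norm L / norm \<xi>1" using nz by (simp add: field_simps)
    also have "\<dots> \<le> B" unfolding B_def using F0 \<xi>1 by (intro member_le_sum) auto
    finally have LB: "\<bar>L \<bullet> z\<bar> \<le> B" .
    have "R \<le> \<bar>\<xi> \<bullet> z\<bar> \<or> \<xi> = 0 \<or> (\<exists>c. \<xi> = c *\<^sub>R L) \<and> \<bar>L \<bullet> z\<bar> \<le> B" if "\<xi> \<in> F" for \<xi>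
    proof (cases "\<xi> \<in> W")
      case True
      then show ?thesis using W LB by (auto simp: span_singleton)
    next
      case False
      then show ?thesis using T(6)[of \<xi>] that by simp
    qed
    then show "\<exists>T g' z. R \<le> T \<and> det g' = 1 \<and> dist g' g < e \<and> lattice_of g' = (\<lambda>v. h_mat T *v v) ` x \<and>
       g' *v z = h_mat T *v p \<and>
       (\<forall>\<xi>\<in>F. R \<le> \<bar>\<xi> \<bullet> z\<bar> \<or> \<xi> = 0 \<or> (\<exists>c. \<xi> = c *\<^sub>R L) \<and> \<bar>L \<bullet> z\<bar> \<le> B)"
      using T by (intro exI[of _ T] exI[of _ g'] exI[of _ z]) auto
  qed
qed

text \<open>If \<open>\<mu>\<close> does not vanish on the first factor, the path has small constant second component;
  otherwise its first component vanishes.\<close>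

lemma norm_product_path:
  fixes \<mu> :: "real^('m::finite + 'n::finite)"
  assumes Nm: "is_norm Nm" and Nn: "is_norm Nn" and \<mu>: "\<mu> \<noteq> 0" and pos: "0 < \<kappa>" "0 < \<epsilon>" "0 < \<alpha>"
  obtains b0 b1 r where "0 < r" "\<And>v. v \<in> {\<kappa>..2*\<kappa>} \<Longrightarrow> \<mu> \<bullet> (b0 + v *\<^sub>R b1) = v"
    "\<And>v. v \<in> {\<kappa>..2*\<kappa>} \<Longrightarrow> r < Nn (vsnd (b0 + v *\<^sub>R b1))"
    "\<And>v. v \<in> {\<kappa>..2*\<kappa>} \<Longrightarrow> Nn (vsnd (b0 + v *\<^sub>R b1)) powr \<alpha> * Nm (vfst (b0 + v *\<^sub>R b1)) < \<epsilon>"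
proof (cases "\<exists>i. \<mu> $ Inl i \<noteq> 0")
  case True
  then obtain i where i: "\<mu> $ Inl i \<noteq> 0" by blast
  obtain j :: 'n where True by simp
  define l where "l = \<mu> $ Inl i"
  define l' where "l' = \<mu> $ Inr j"
  define Ci where "Ci = Nm (axis i 1)"
  define Cj where "Cj = Nn (axis j 1)"
  have Cj: "Cj > 0" unfolding Cj_def by (intro is_norm_pos Nn) simp
  have Ci: "Ci \<ge> 0" unfolding Ci_def by (intro is_norm_nonneg Nm)
  have ev: "\<forall>\<^sub>F s in at_right 0. 0 \<le> s * Cj"
    using eventually_at_right_less[of "0::real"] by (rule eventually_mono) (use Cj in auto)
  \<comment> \<open>Shrinking the second component to 0 beats the first component, which stays
    bounded along the path.\<close>
  have "((\<lambda>s. (s * Cj) powr \<alpha> * ((2 * \<kappa> + s * \<bar>l'\<bar>) / \<bar>l\<bar> * Ci)) \<longlongrightarrow> (0 * Cj) powr \<alpha> * ((2 * \<kappa> + 0 * \<bar>l'\<bar>) / \<bar>l\<bar> * Ci)) (at_right 0)"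
    by (intro tendsto_intros) (use pos ev i l_def in auto)
  then have "\<forall>\<^sub>F s in at_right 0. (s * Cj) powr \<alpha> * ((2 * \<kappa> + s * \<bar>l'\<bar>) / \<bar>l\<bar> * Ci) < \<epsilon>"
    using pos by (intro order_tendstoD) auto
  then have "\<forall>\<^sub>F s in at_right 0. 0 < s \<and> (s * Cj) powr \<alpha> * ((2 * \<kappa> + s * \<bar>l'\<bar>) / \<bar>l\<bar> * Ci) < \<epsilon>"
    by (intro eventually_conj eventually_at_right_less)
  then obtain s :: real where s: "0 < s" "(s * Cj) powr \<alpha> * ((2 * \<kappa> + s * \<bar>l'\<bar>) / \<bar>l\<bar> * Ci) < \<epsilon>"
    using eventually_happens'[OF trivial_limit_at_right_real] by blast
  \<comment> \<open>The correction along the first factor gives \<mu> \<bullet> b0 = 0, while \<mu>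
    \<bullet> b1 = 1.\<close>
  define b0 :: "real^('m + 'n)" where "b0 = s *\<^sub>R axis (Inr j) 1 - (s * l' / l) *\<^sub>R axis (Inl i) 1"
  define b1 :: "real^('m + 'n)" where "b1 = (1 / l) *\<^sub>R axis (Inl i) 1"
  have f: "vfst (b0 + v *\<^sub>R b1) = ((v - s * l') / l) *\<^sub>R axis i 1" for v
    by (simp add: b0_def b1_def scaleR_left_diff_distrib[symmetric] diff_divide_distrib)
  have sn: "vsnd (b0 + v *\<^sub>R b1) = s *\<^sub>R axis j 1" for v
    by (simp add: b0_def b1_def)
  show ?thesis
  proof (rule that[of "s * Cj / 2" b0 b1])
    show "0 < s * Cj / 2" using s Cj by simp
    fix v assume v: "v \<in> {\<kappa>..2*\<kappa>}"
    show "\<mu> \<bullet> (b0 + v *\<^sub>R b1) = v"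
      using i by (simp add: b0_def b1_def inner_add_right inner_diff_right inner_axis l_def l'_def)
    have n: "Nn (vsnd (b0 + v *\<^sub>R b1)) = s * Cj"
      unfolding sn using s by (simp add: is_norm_scaleR[OF Nn] Cj_def)
    show "s * Cj / 2 < Nn (vsnd (b0 + v *\<^sub>R b1))" using n s Cj by simp
    have "Nm (vfst (b0 + v *\<^sub>R b1)) = \<bar>v - s * l'\<bar> / \<bar>l\<bar> * Ci"
      unfolding f by (simp add: is_norm_scaleR[OF Nm] Ci_def)
    also have "\<dots> \<le> (2 * \<kappa> + s * \<bar>l'\<bar>) / \<bar>l\<bar> * Ci"
    proof (intro mult_right_mono divide_right_mono Ci)
      have "\<bar>v - s * l'\<bar> \<le> \<bar>v\<bar> + \<bar>s * l'\<bar>" by (rule abs_triangle_ineq4)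
      also have "\<dots> \<le> 2 * \<kappa> + s * \<bar>l'\<bar>" using v s pos by (simp add: abs_mult)
      finally show "\<bar>v - s * l'\<bar> \<le> 2 * \<kappa> + s * \<bar>l'\<bar>" .
    qed simp
    finally have "(s * Cj) powr \<alpha> * Nm (vfst (b0 + v *\<^sub>R b1)) \<le> (s * Cj) powr \<alpha> * ((2 * \<kappa> + s * \<bar>l'\<bar>) / \<bar>l\<bar> * Ci)"
      by (rule mult_left_mono) simp
    then show "Nn (vsnd (b0 + v *\<^sub>R b1)) powr \<alpha> * Nm (vfst (b0 + v *\<^sub>R b1)) < \<epsilon>"
      using s(2) n by simp
  qed
next
  case False
  have "\<exists>j. \<mu> $ Inr j \<noteq> 0"
  proof (rule ccontr)
    assume "\<not> ?thesis"
    then have "\<mu> $ k = 0" for k using False by (cases k) auto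
    then show False using \<mu> by (simp add: vec_eq_iff)
  qed
  then obtain j where j: "\<mu> $ Inr j \<noteq> 0" by blast
  define l where "l = \<mu> $ Inr j"
  define Cj where "Cj = Nn (axis j 1)"
  have Cj: "Cj > 0" unfolding Cj_def by (intro is_norm_pos Nn) simp
  define b1 :: "real^('m + 'n)" where "b1 = (1 / l) *\<^sub>R axis (Inr j) 1"
  show ?thesis
  proof (rule that[of "\<kappa> / \<bar>l\<bar> * Cj / 2" 0 b1])
    show "0 < \<kappa> / \<bar>l\<bar> * Cj / 2" using pos Cj j by (simp add: l_def)
    fix v assume v: "v \<in> {\<kappa>..2*\<kappa>}"
    show "\<mu> \<bullet> (0 + v *\<^sub>R b1) = v" using j by (simp add: b1_def inner_axis l_def)
    have n: "Nn (vsnd (0 + v *\<^sub>R b1)) = \<bar>v\<bar> / \<bar>l\<bar> * Cj" by (simp add: b1_def is_norm_scaleR[OF Nn] Cj_def)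
    have "0 < \<kappa> / \<bar>l\<bar> * Cj" using pos Cj j by (simp add: l_def)
    moreover have "x / 2 < x" if "0 < x" for x :: real using that by simp
    ultimately have "\<kappa> / \<bar>l\<bar> * Cj / 2 < \<kappa> / \<bar>l\<bar> * Cj" by blast
    also have "\<dots> \<le> \<bar>v\<bar> / \<bar>l\<bar> * Cj" using v Cj pos by (intro mult_right_mono divide_right_mono) auto
    finally show "\<kappa> / \<bar>l\<bar> * Cj / 2 < Nn (vsnd (0 + v *\<^sub>R b1))" using n by simp
    have "Nm (vfst (0 + v *\<^sub>R b1)) = 0" by (simp add: b1_def is_norm_eq_0[OF Nm])
    then show "Nn (vsnd (0 + v *\<^sub>R b1)) powr \<alpha> * Nm (vfst (0 + v *\<^sub>R b1)) < \<epsilon>" using pos by simp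
  qed
qed

text \<open>With \<kappa> = |L_i|, integer multiples of the i-th axis shift the level in steps of
  \<kappa>, the length of the target interval. This confines the hyperplane levels to a compact set
  away from 0.\<close>

lemma integer_shift:
  fixes L :: "real^'k"
  assumes "L \<noteq> 0"
  obtains \<kappa> where "0 < \<kappa>" "\<And>u. \<exists>y\<in>int_vectors. u + L \<bullet> y \<in> {\<kappa>..2*\<kappa>}"
proof -
  obtain i where i: "L $ i \<noteq> 0" using assms by (auto simp: vec_eq_iff)
  define \<kappa> where "\<kappa> = \<bar>L $ i\<bar>"
  have \<kappa>: "\<kappa> > 0" using i by (simp add: \<kappa>_def)
  show ?thesis
  proof (rule that[OF \<kappa>])
    fix u
    define k where "k = \<lceil>(\<kappa> - u) / \<kappa>\<rceil>"
    have k: "(\<kappa> - u) / \<kappa> \<le> of_int k" "of_int k < (\<kappa> - u) / \<kappa> + 1" unfolding k_def by linarith+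
    then have k': "\<kappa> \<le> u + of_int k * \<kappa>" "u + of_int k * \<kappa> \<le> 2 * \<kappa>" using \<kappa> by (simp_all add: field_simps)
    define y :: "real^'k" where "y = axis i (of_int k * sgn (L $ i))"
    have "y \<in> int_vectors" by (auto simp: y_def int_vectors_def axis_def sgn_if)
    moreover have "L \<bullet> y = of_int k * \<kappa>" by (simp add: y_def inner_axis \<kappa>_def abs_sgn)
    ultimately show "\<exists>y\<in>int_vectors. u + L \<bullet> y \<in> {\<kappa>..2*\<kappa>}" using k' by (intro bexI[of _ y]) auto
  qed
qed

lemma cos_add_integer: "k \<in> \<int> \<Longrightarrow> cos (2 * pi * (x + k)) = cos (2 * pi * x)"
  using cos.plus_of_int[of "2 * pi * x"] by (auto elim!: Ints_cases simp: algebra_simps)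

subsection \<open>Grids near the last accumulation point\<close>

lemma open_norm_product_region:
  fixes Nm :: "real^'m \<Rightarrow> real" and Nn :: "real^'n \<Rightarrow> real"
  assumes "is_norm Nm" "is_norm Nn" "0 < \<alpha>"
  shows "open {x :: real^('m::finite + 'n::finite). r < Nn (vsnd x) \<and> Nn (vsnd x) powr \<alpha> * Nm (vfst x) < \<epsilon>}"
proof -
  have "continuous_on UNIV (\<lambda>x :: real^('m + 'n). Nn (vsnd x) powr \<alpha>)"
    using assms is_norm_nonneg[OF assms(2)] by (intro continuous_on_powr' continuous_intros) auto
  then have "open {x :: real^('m + 'n). Nn (vsnd x) powr \<alpha> * Nm (vfst x) < \<epsilon>}"
    by (intro open_Collect_less continuous_on_mult continuous_on_const is_norm_continuous_on[OF assms(1)]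
        continuous_on_vfst continuous_on_id)
  moreover have "open {x :: real^('m + 'n). r < Nn (vsnd x)}"
    using assms by (intro open_Collect_less continuous_intros)
  ultimately have "open ({x :: real^('m + 'n). r < Nn (vsnd x)} \<inter> {x. Nn (vsnd x) powr \<alpha> * Nm (vfst x) < \<epsilon>})"
    by (rule open_Int[rotated])
  then show ?thesis by (simp add: Collect_conj_eq)
qed

text \<open>The path is compact, so a single \<epsilon>-neighbourhood of all pairs of matrix and
  path point lies in the open preimage of \<open>V\<close>.\<close>

lemma uniform_matrix_neighbourhood:
  fixes g :: "real^'k^'k" and a :: "real \<Rightarrow> real^'k"
  assumes V: "open V" and a: "continuous_on {c..d} a" "\<And>v. v \<in> {c..d} \<Longrightarrow> g *v a v \<in> V"
  obtains e \<delta> where "0 < e" "0 < \<delta>" "\<delta> < 1/2"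
    "\<And>g' v a'. dist g' g < e \<Longrightarrow> v \<in> {c..d} \<Longrightarrow> (\<And>i. \<bar>(a' - a v) $ i\<bar> \<le> \<delta>) \<Longrightarrow> g' *v a' \<in> V"
proof -
  let ?f = "\<lambda>P. fst P *v snd P :: real^'k"
  have o: "open (?f -` V)" by (intro open_vimage V continuous_intros)
  have k: "compact ({g} \<times> a ` {c..d})"
    using a(1) by (intro compact_Times compact_continuous_image) auto
  have sub: "{g} \<times> a ` {c..d} \<subseteq> ?f -` V" using a(2) by auto
  obtain \<epsilon> where \<epsilon>: "\<epsilon> > 0" "(\<Union>P\<in>{g} \<times> a ` {c..d}. ball P \<epsilon>) \<subseteq> ?f -` V"
    by (rule compact_subset_open_imp_ball_epsilon_subset[OF k o sub])
  \<comment> \<open>The divisor turns coordinatewise bounds into a Euclidean distance of at most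
    \<epsilon>/4; the cap 1/4 meets the condition of the cube lemma.\<close>
  define \<delta> where "\<delta> = min (1/4) (\<epsilon> / (4 * CARD('k)))"
  have \<delta>: "0 < \<delta>" "\<delta> < 1/2" using \<epsilon> by (auto simp: \<delta>_def)
  show ?thesis
  proof (rule that[of "\<epsilon> / 2" \<delta>])
    fix g' v a' assume g': "dist g' g < \<epsilon> / 2" and v: "v \<in> {c..d}" and a': "\<And>i. \<bar>(a' - a v) $ i\<bar> \<le> \<delta>"
    have "dist a' (a v) \<le> (\<Sum>i\<in>UNIV. \<bar>(a' - a v) $ i\<bar>)" unfolding dist_norm by (rule norm_le_l1_cart)
    also have "\<dots> \<le> (\<Sum>i\<in>(UNIV :: 'k set). \<delta>)" using a' by (intro sum_mono) auto
    also have "\<dots> \<le> CARD('k) * (\<epsilon> / (4 * CARD('k)))"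
      unfolding sum_constant by (intro mult_left_mono) (auto simp: \<delta>_def)
    also have "\<dots> = \<epsilon> / 4" by simp
    finally have da: "dist a' (a v) \<le> \<epsilon> / 4" .
    have "dist (g, a v) (g', a') \<le> dist g g' + dist (a v) a'"
      unfolding dist_Pair_Pair by (rule sqrt_sum_squares_le_sum) auto
    also have "\<dots> < \<epsilon>" using g' da \<epsilon>(1) by (simp add: dist_commute)
    finally have "(g', a') \<in> ball (g, a v) \<epsilon>" by simp
    then have "(g', a') \<in> ?f -` V" using \<epsilon>(2) v by blast
    then show "g' *v a' \<in> V" by simp
  qed (use \<delta> \<epsilon> in auto)
qed

text \<open>On a short interval the level of the grid along \<open>L\<close> is almost constant, and
  the path supplies a point of the open region \<open>V\<close> at that level. The cube lemma,
  applied to the orbit recentred at this point, puts grid points in \<open>V\<close> for a fixed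
  proportion of \<open>t\<close>. Undoing the flow preserves the product of norms and makes
  \<open>q\<close> long.\<close>

lemma approximations_have_positive_proportion:
  fixes A :: "real^'n::finite^'m::finite" and Nm :: "real^'m \<Rightarrow> real" and Nn :: "real^'n \<Rightarrow> real"
    and g :: "real^('m + 'n)^('m + 'n)"
  assumes Nm: "is_norm Nm" and Nn: "is_norm Nn"
    and r: "reachable (x_lattice A) (vinl p0) g W" and W: "W \<subseteq> span {L}" and L: "L \<noteq> 0"
    and g: "det g = 1" and \<epsilon>: "0 < \<epsilon>"
  obtains c h where "0 < c" "0 < h" "\<forall>a b N0. a < b \<longrightarrow> b - a \<le> h \<longrightarrow>
     (\<exists>G. G \<in> lmeasurable \<and> c * (b - a) \<le> measure lebesgue G \<and>
       G \<subseteq> {t\<in>{a..b}. \<exists>q\<in>int_vectors. \<exists>k\<in>int_vectors. N0 \<le> Nn q \<and>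
          Nn q powr (real CARD('n) / real CARD('m)) * Nm (A *v q - (t *\<^sub>R p0 + \<eta>) - k) < \<epsilon>})"
proof -
  define \<alpha> where "\<alpha> = real CARD('n) / real CARD('m)"
  have \<alpha>: "\<alpha> > 0" by (simp add: \<alpha>_def)
  obtain B where B: "0 \<le> B" and tame: "\<And>F R e. finite F \<Longrightarrow> F \<subseteq> int_vectors \<Longrightarrow> 0 < e \<Longrightarrow>
     \<exists>T g' z. R \<le> T \<and> det g' = 1 \<and> dist g' g < e \<and> lattice_of g' = (\<lambda>v. h_mat T *v v) ` x_lattice A \<and>
       g' *v z = h_mat T *v vinl p0 \<and>
       (\<forall>\<xi>\<in>F. R \<le> \<bar>\<xi> \<bullet> z\<bar> \<or> \<xi> = 0 \<or> (\<exists>c. \<xi> = c *\<^sub>R L) \<and> \<bar>L \<bullet> z\<bar> \<le> B)"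
    using reachable_tame[OF r W] by blast
  obtain gi where gi: "g ** gi = mat 1" "gi ** g = mat 1" using det_1_inverse[OF g] by blast
  obtain \<kappa> where \<kappa>: "0 < \<kappa>" and shift: "\<And>u. \<exists>y\<in>int_vectors. u + L \<bullet> y \<in> {\<kappa>..2*\<kappa>}"
    using integer_shift[OF L] by blast
  have "L v* gi \<noteq> 0"
  proof
    assume "L v* gi = 0"
    then have "L v* gi v* g = 0" by simp
    then show False using L by (simp add: vector_matrix_mul_assoc gi)
  qed
  then obtain b0 b1 r0 where r0: "0 < r0" and path: "\<And>v. v \<in> {\<kappa>..2*\<kappa>} \<Longrightarrow> (L v* gi) \<bullet> (b0 + v *\<^sub>R b1) = v"
    "\<And>v. v \<in> {\<kappa>..2*\<kappa>} \<Longrightarrow> r0 < Nn (vsnd (b0 + v *\<^sub>R b1))"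
    "\<And>v. v \<in> {\<kappa>..2*\<kappa>} \<Longrightarrow> Nn (vsnd (b0 + v *\<^sub>R b1)) powr \<alpha> * Nm (vfst (b0 + v *\<^sub>R b1)) < \<epsilon>"
    by (rule norm_product_path[OF Nm Nn _ \<kappa> \<epsilon> \<alpha>]) blast
  define V where "V = {x :: real^('m + 'n). r0 < Nn (vsnd x) \<and> Nn (vsnd x) powr \<alpha> * Nm (vfst x) < \<epsilon>}"
  have V: "open V" unfolding V_def by (rule open_norm_product_region[OF Nm Nn \<alpha>])
  define a where "a v = gi *v (b0 + v *\<^sub>R b1)" for v
  have La: "L \<bullet> a v = v" if "v \<in> {\<kappa>..2*\<kappa>}" for v
    using path(1)[OF that] by (simp add: a_def dot_lmul_matrix)
  have ac: "continuous_on {\<kappa>..2*\<kappa>} a" unfolding a_def by (intro continuous_intros)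
  have aV: "g *v a v \<in> V" if "v \<in> {\<kappa>..2*\<kappa>}" for v
    using path(2,3)[OF that] by (simp add: a_def V_def matrix_vector_mul_assoc gi)
  obtain e \<delta> where e: "0 < e" and \<delta>: "0 < \<delta>" "\<delta> < 1/2"
    and nbd: "\<And>g' v a'. dist g' g < e \<Longrightarrow> v \<in> {\<kappa>..2*\<kappa>} \<Longrightarrow> (\<And>i. \<bar>(a' - a v) $ i\<bar> \<le> \<delta>) \<Longrightarrow> g' *v a' \<in> V"
    using uniform_matrix_neighbourhood[OF V ac aV] by blast
  obtain S :: "(real^('m + 'n)) set" and c M :: real where S: "finite S" "S \<subseteq> int_vectors" and c: "0 < c" "c < 1" and M: "0 < M"
    and hits: "\<forall>(z::real^('m + 'n)) w a b. a < b \<longrightarrow>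
      (\<forall>\<xi>\<in>S. \<bar>\<xi> \<bullet> z\<bar> * (b - a) \<ge> M \<or> (\<forall>t\<in>{a..b}. cos (2 * pi * (\<xi> \<bullet> (t *\<^sub>R z + w))) \<ge> 0)) \<longrightarrow>
      (\<exists>G. G \<in> lmeasurable \<and> measure lebesgue G \<ge> c * (b - a) \<and>
        G \<subseteq> {t\<in>{a..b}. \<exists>y\<in>int_vectors. \<forall>i. \<bar>(t *\<^sub>R z + w + y) $ i\<bar> \<le> \<delta>})"
    by (rule interval_orbit_hits_cube[OF \<delta>])
  \<comment> \<open>If \<xi> \<in> S is c' times \<open>L\<close>, then |c'| \<le> K.\<close>
  define K where "K = (\<Sum>\<xi>\<in>S. norm \<xi> / norm L)"
  have K: "norm \<xi> / norm L \<le> K" if "\<xi> \<in> S" for \<xi>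
    unfolding K_def using S that by (intro member_le_sum) auto
  have K0: "0 \<le> K" unfolding K_def by (intro sum_nonneg) auto
  \<comment> \<open>Then |t - t0| |\<xi> \<bullet> z| \<le> 1/4 for each slow \<xi>, so its angle
    from the midpoint stays within pi/2 and the cosine is nonnegative.\<close>
  define h where "h = 1 / (2 * (K * B + 1))"
  have KB: "0 \<le> K * B" using K0 B by simp
  have h0: "0 < h" unfolding h_def using KB by simp
  show ?thesis
  proof (rule that[of c h])
    show "0 < c" by (rule c(1))
    show "0 < h" by (rule h0)
  next
    show "\<forall>a b N0. a < b \<longrightarrow> b - a \<le> h \<longrightarrow>
     (\<exists>G. G \<in> lmeasurable \<and> c * (b - a) \<le> measure lebesgue G \<and>
       G \<subseteq> {t\<in>{a..b}. \<exists>q\<in>int_vectors. \<exists>k\<in>int_vectors. N0 \<le> Nn q \<and>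
          Nn q powr (real CARD('n) / real CARD('m)) * Nm (A *v q - (t *\<^sub>R p0 + \<eta>) - k) < \<epsilon>})"
    proof (intro allI impI)
      fix s1 s2 N0 :: real assume s: "s1 < s2" "s2 - s1 \<le> h"
      \<comment> \<open>The first term makes characters oscillate on the given interval, the last
        forces the norm of \<open>q\<close> above \<open>N0\<close>, and 0 keeps the time
        nonnegative.\<close>
      define R where "R = max (M / (s2 - s1)) (max 0 (N0 / r0))"
      obtain T g' z where T: "R \<le> T" and g': "det g' = 1" "dist g' g < e"
        and lat: "lattice_of g' = (\<lambda>v. h_mat T *v v) ` x_lattice A" and z: "g' *v z = h_mat T *v vinl p0"
        and alt: "\<And>\<xi>. \<xi> \<in> S \<Longrightarrow> R \<le> \<bar>\<xi> \<bullet> z\<bar> \<or> \<xi> = 0 \<or> (\<exists>c. \<xi> = c *\<^sub>R L) \<and> \<bar>L \<bullet> z\<bar> \<le> B"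
        using tame[OF S e, of R] by blast
      obtain gi' where gi': "g' ** gi' = mat 1" using det_1_inverse[OF g'(1)] by blast
      define w where "w = gi' *v (h_mat T *v vinl \<eta>)"
      have w: "g' *v w = h_mat T *v vinl \<eta>" by (simp add: w_def matrix_vector_mul_assoc matrix_mul_assoc gi')
      define t0 where "t0 = (s1 + s2) / 2"
      \<comment> \<open>An integral translation brings the level at the midpoint into the range of
        the path.\<close>
      obtain y0 where y0: "y0 \<in> int_vectors" and v: "- (L \<bullet> (t0 *\<^sub>R z + w)) + L \<bullet> y0 \<in> {\<kappa>..2*\<kappa>}"
        using shift by blast
      define v where "v = - (L \<bullet> (t0 *\<^sub>R z + w)) + L \<bullet> y0"
      have vI: "v \<in> {\<kappa>..2*\<kappa>}" using v by (simp add: v_def)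
      have "\<exists>G. G \<in> lmeasurable \<and> c * (s2 - s1) \<le> measure lebesgue G \<and>
          G \<subseteq> {t\<in>{s1..s2}. \<exists>y\<in>int_vectors. \<forall>i. \<bar>(t *\<^sub>R (- z) + (- w - a v) + y) $ i\<bar> \<le> \<delta>}"
      proof (rule hits[rule_format, OF s(1)])
        fix \<xi> assume \<xi>: "\<xi> \<in> S"
        consider "R \<le> \<bar>\<xi> \<bullet> z\<bar>" | "\<xi> = 0" | c' where "\<xi> = c' *\<^sub>R L" "\<bar>L \<bullet> z\<bar> \<le> B"
          using alt[OF \<xi>] by blast
        then show "M \<le> \<bar>\<xi> \<bullet> (- z)\<bar> * (s2 - s1) \<or> (\<forall>t\<in>{s1..s2}. 0 \<le> cos (2 * pi * (\<xi> \<bullet> (t *\<^sub>R (- z) + (- w - a v)))))"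
        proof cases
          case 1
          then have "M / (s2 - s1) \<le> \<bar>\<xi> \<bullet> z\<bar>" by (simp add: R_def)
          then show ?thesis using s by (simp add: field_simps)
        next
          case 2
          then show ?thesis by simp
        next
          case 3
          \<comment> \<open>At \<open>t0\<close> the phase is the integer -(\<xi> \<bullet> y0), so
            only the small drift away from the midpoint is left.\<close>
          have "0 \<le> cos (2 * pi * (\<xi> \<bullet> (t *\<^sub>R (- z) + (- w - a v))))" if t: "t \<in> {s1..s2}" for t
          proof -
            have "\<xi> \<bullet> (t *\<^sub>R (- z) + (- w - a v)) = - (t - t0) * (\<xi> \<bullet> z) - c' * (L \<bullet> (t0 *\<^sub>R z + w) + L \<bullet> a v)"
              by (simp add: 3(1) inner_add_right inner_diff_right algebra_simps)
            also have "L \<bullet> (t0 *\<^sub>R z + w) + L \<bullet> a v = L \<bullet> y0" unfolding La[OF vI] by (simp add: v_def)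
            also have "- (t - t0) * (\<xi> \<bullet> z) - c' * (L \<bullet> y0) = - (t - t0) * (\<xi> \<bullet> z) + - (\<xi> \<bullet> y0)" by (simp add: 3(1))
            finally have eq: "\<xi> \<bullet> (t *\<^sub>R (- z) + (- w - a v)) = - (t - t0) * (\<xi> \<bullet> z) + - (\<xi> \<bullet> y0)" .
            have "- (\<xi> \<bullet> y0) \<in> \<int>" using S(2) \<xi> y0 int_vectors_inner by (meson Ints_minus subsetD)
            then have "cos (2 * pi * (\<xi> \<bullet> (t *\<^sub>R (- z) + (- w - a v)))) = cos (2 * pi * (- (t - t0) * (\<xi> \<bullet> z)))"
              unfolding eq by (rule cos_add_integer)
            also have "\<dots> \<ge> 0"
            proof (rule cos_ge_zero)
              have c'K: "\<bar>c'\<bar> \<le> K" using K[OF \<xi>] L by (simp add: 3(1))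
              have "\<bar>- (t - t0) * (\<xi> \<bullet> z)\<bar> = \<bar>t - t0\<bar> * (\<bar>c'\<bar> * \<bar>L \<bullet> z\<bar>)"
                by (simp add: 3(1) abs_mult abs_minus_commute)
              also have "\<dots> \<le> h / 2 * (K * B)"
              proof (intro mult_mono)
                have "\<bar>t - t0\<bar> \<le> (s2 - s1) / 2" using t unfolding t0_def by (auto simp: abs_le_iff field_simps)
                then show "\<bar>t - t0\<bar> \<le> h / 2" using s by simp
              qed (use c'K 3(2) K0 B h0 in auto)
              also have "\<dots> \<le> 1/4" unfolding h_def using KB by (simp add: field_simps)
              finally have le: "\<bar>- (t - t0) * (\<xi> \<bullet> z)\<bar> \<le> 1/4" .
              have le2: "\<bar>2 * pi * (- (t - t0) * (\<xi> \<bullet> z))\<bar> \<le> 2 * pi * (1/4)"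
                unfolding abs_mult[of "2 * pi"] by (intro mult_mono le) auto
              show "- (pi / 2) \<le> 2 * pi * (- (t - t0) * (\<xi> \<bullet> z))" using le2 by linarith
              show "2 * pi * (- (t - t0) * (\<xi> \<bullet> z)) \<le> pi / 2" using le2 by linarith
            qed
            finally show ?thesis .
          qed
          then show ?thesis by blast
        qed
      qed
      then obtain G where G: "G \<in> lmeasurable" "c * (s2 - s1) \<le> measure lebesgue G"
        and Gsub: "G \<subseteq> {t\<in>{s1..s2}. \<exists>y\<in>int_vectors. \<forall>i. \<bar>(t *\<^sub>R (- z) + (- w - a v) + y) $ i\<bar> \<le> \<delta>}" by blast
      have "\<exists>q\<in>int_vectors. \<exists>k\<in>int_vectors. N0 \<le> Nn q \<and>
            Nn q powr \<alpha> * Nm (A *v q - (t *\<^sub>R p0 + \<eta>) - k) < \<epsilon>" if t: "t \<in> G" for t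
      proof -
        obtain y where y: "y \<in> int_vectors" "\<And>i. \<bar>(t *\<^sub>R (- z) + (- w - a v) + y) $ i\<bar> \<le> \<delta>"
          using Gsub t by blast
        define a' where "a' = y - (t *\<^sub>R z + w)"
        have "g' *v a' \<in> V"
        proof (rule nbd[OF g'(2) vI])
          fix i
          have "a' - a v = t *\<^sub>R (- z) + (- w - a v) + y" by (simp add: a'_def)
          then show "\<bar>(a' - a v) $ i\<bar> \<le> \<delta>" using y(2)[of i] by simp
        qed
        have "g' *v y \<in> lattice_of g'" using y(1) by (auto simp: lattice_of_def)
        then have "g' *v y \<in> (\<lambda>v. h_mat T *v v) ` (\<lambda>z. u_mat A *v z) ` int_vectors"
          unfolding lat unfolding x_lattice_def lattice_of_def .
        then obtain k where k: "k \<in> int_vectors" "g' *v y = h_mat T *v (u_mat A *v k)"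
          by blast
        define X where "X = u_mat A *v k - vinl (t *\<^sub>R p0 + \<eta>)"
        have X: "g' *v a' = h_mat T *v X"
          by (simp add: a'_def X_def matrix_vector_mult_diff_distrib matrix_vector_right_distrib
              matrix_vector_mult_scaleR k(2) z w vinl_scaleR_add)
        have Xs: "vsnd X = vsnd k" by (simp add: X_def vsnd_u_mat)
        have Xf: "vfst X = A *v vsnd k - (t *\<^sub>R p0 + \<eta>) - (- vfst k)" by (simp add: X_def vfst_u_mat algebra_simps)
        let ?m = "real CARD('m)" and ?n = "real CARD('n)"
        have V1: "r0 < exp (- ?m * T) * Nn (vsnd k)"
          and V2: "(exp (- ?m * T) * Nn (vsnd k)) powr \<alpha> * (exp (?n * T) * Nm (vfst X)) < \<epsilon>"
          using \<open>g' *v a' \<in> V\<close> unfolding X V_def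
          by (simp_all add: vsnd_h_mat vfst_h_mat Xs is_norm_scaleR[OF Nn] is_norm_scaleR[OF Nm])
        \<comment> \<open>As \<alpha> = n / m, the contraction of the second factor cancels the
          expansion of the first exactly.\<close>
        have "(exp (- ?m * T) * Nn (vsnd k)) powr \<alpha> = exp (- (?n * T)) * Nn (vsnd k) powr \<alpha>"
        proof -
          have "(exp (- ?m * T) * Nn (vsnd k)) powr \<alpha> = exp (- ?m * T) powr \<alpha> * Nn (vsnd k) powr \<alpha>"
            by (rule powr_mult)
          also have "exp (- ?m * T) powr \<alpha> = exp (- (?n * T))"
            by (simp add: exp_powr_real \<alpha>_def)
          finally show ?thesis .
        qed
        then have "exp (- (?n * T)) * exp (?n * T) * (Nn (vsnd k) powr \<alpha> * Nm (vfst X)) < \<epsilon>"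
          using V2 by (simp add: mult_ac)
        then have C1: "Nn (vsnd k) powr \<alpha> * Nm (vfst X) < \<epsilon>" by (simp add: exp_add[symmetric])
        have C2: "N0 \<le> Nn (vsnd k)"
        proof -
          have T0: "0 \<le> T" "N0 / r0 \<le> T" using T by (auto simp: R_def)
          have "N0 \<le> T * r0" using T0 r0 by (simp add: field_simps)
          also have "\<dots> \<le> exp (?m * T) * r0"
          proof (rule mult_right_mono)
            have "T \<le> ?m * T" using T0 by (simp add: mult_le_cancel_right1 Suc_leI)
            then show "T \<le> exp (?m * T)" using exp_ge_add_one_self[of "?m * T"] by linarith
          qed (use r0 in simp)
          also have "\<dots> \<le> exp (?m * T) * (exp (- ?m * T) * Nn (vsnd k))"
            using V1 by (intro mult_left_mono) auto
          also have "\<dots> = Nn (vsnd k)" by (simp add: mult.assoc[symmetric] exp_add[symmetric])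
          finally show ?thesis .
        qed
        show ?thesis
          using C1 C2 k(1) int_vectors_vsnd[OF k(1)] int_vectors_uminus[OF int_vectors_vfst[OF k(1)]] unfolding Xf
          by blast
      qed
      then show "\<exists>G. G \<in> lmeasurable \<and> c * (s2 - s1) \<le> measure lebesgue G \<and>
         G \<subseteq> {t\<in>{s1..s2}. \<exists>q\<in>int_vectors. \<exists>k\<in>int_vectors. N0 \<le> Nn q \<and>
            Nn q powr (real CARD('n) / real CARD('m)) * Nm (A *v q - (t *\<^sub>R p0 + \<eta>) - k) < \<epsilon>}"
        using G Gsub unfolding \<alpha>_def by (intro exI[of _ G]) blast
    qed
  qed
qed

text \<open>The first accumulation point leaves a hyperplane of bad characters, and each further one
  removes at least one dimension while any is left.\<close>

lemma accumulation_sequence_reachable: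
  fixes x :: "(real^('m::finite + 'n::finite)) set"
  assumes cop: "coprime CARD('m) CARD('n)" and acc: "accumulation_sequence x xs"
    and p: "\<And>j. p $ Inr j = 0" "p \<noteq> 0" and i: "Suc i < length xs" "Suc i < CARD('m) + CARD('n)"
  shows "\<exists>g W. det g = 1 \<and> xs ! Suc i = lattice_of g \<and> subspace W \<and>
    dim W \<le> CARD('m) + CARD('n) - Suc i \<and> reachable x p g W"
  using i
proof (induction i)
  have lat: "\<exists>g. det g = 1 \<and> xs ! k = lattice_of g" if "k < length xs" for k
  proof -
    have "xs ! k \<in> unimodular_lattices" using acc that by (auto simp: accumulation_sequence_def)
    then show ?thesis by (auto simp: unimodular_lattices_def SL_def)
  qed
  have bd: "xs ! Suc k \<in> boundary_set (xs ! k)" if "Suc k < length xs" for k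
    using acc that by (auto simp: accumulation_sequence_def)
  {
    case 0
    obtain g where g: "det g = 1" "xs ! Suc 0 = lattice_of g" using lat 0 by blast
    have y: "lattice_of g \<in> boundary_set x"
      using bd[OF 0(1)] g acc by (simp add: accumulation_sequence_def)
    obtain gi where gi: "g ** gi = mat 1" using det_1_inverse[OF g(1)] by blast
    define q where "q = gi *v p"
    have q: "g *v q = p" by (simp add: q_def matrix_vector_mul_assoc gi)
    then have "q \<noteq> 0" using p(2) by auto
    then have "dim {\<xi>. q \<bullet> \<xi> = 0} = CARD('m) + CARD('n) - 1" by (simp add: dim_hyperplane card_UNIV_sum)
    then show ?case
      using g reachable_first_step[OF y g(1) p(1) q] subspace_hyperplane[of q]
      by (intro exI[of _ g] exI[of _ "{\<xi>. q \<bullet> \<xi> = 0}"]) auto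
  next
    case (Suc i)
    then obtain g W where g: "det g = 1" "xs ! Suc i = lattice_of g" and W: "subspace W"
      "dim W \<le> CARD('m) + CARD('n) - Suc i" and r: "reachable x p g W" by auto
    obtain g1 where g1: "det g1 = 1" "xs ! Suc (Suc i) = lattice_of g1" using lat Suc(2) by blast
    have y: "lattice_of g1 \<in> boundary_set (lattice_of g)" using bd[OF Suc(2)] g g1 by simp
    have "dim W < CARD('m) + CARD('n)" using W(2) Suc(3) by linarith
    then obtain W' where "subspace W'" "dim W' \<le> dim W - 1" "reachable x p g1 W'"
      using reachable_step[OF cop r g(1) W(1) _ g1(1) y] by blast
    then show ?case using g1 W(2) by (intro exI[of _ g1] exI[of _ W']) auto
  }
qed

text \<open>For trivial \<open>W\<close> an arbitrary axis serves, so that a nonzero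
  \<open>L\<close> is always available.\<close>

lemma dim_le_1_subset_span:
  fixes W :: "(real^'k) set"
  assumes "dim W \<le> 1"
  obtains L where "L \<noteq> 0" "W \<subseteq> span {L}"
proof -
  obtain B where B: "B \<subseteq> W" "independent B" "W \<subseteq> span B" "card B = dim W"
    using basis_exists by blast
  have "finite B" using B(2) independent_bound by blast
  then consider "B = {}" | L where "B = {L}"
  proof -
    have "card B = 0 \<or> card B = 1" using B(4) assms by linarith
    then show thesis using that \<open>finite B\<close> by (auto simp: card_1_singleton_iff)
  qed
  then show ?thesis
  proof cases
    case 1
    then have "W \<subseteq> span {axis undefined 1}" using B(3) by (auto simp: span_0)
    then show ?thesis by (rule that[rotated]) (simp add: axis_eq_0_iff)
  next
    case 2
    then show ?thesis using B by (intro that[of L]) (auto simp: dependent_zero)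
  qed
qed

section \<open>From positive proportion to almost every parameter\<close>

lemma dist_to_int_nonneg: "is_norm N \<Longrightarrow> 0 \<le> dist_to_int N z"
  unfolding dist_to_int_def using int_vectors_0 by (intro cINF_greatest) (auto intro: is_norm_nonneg)

lemma dist_to_int_le: "is_norm N \<Longrightarrow> p \<in> int_vectors \<Longrightarrow> dist_to_int N z \<le> N (z - p)"
  unfolding dist_to_int_def using is_norm_nonneg[of N] by (intro cINF_lower) (auto intro!: bdd_belowI[of _ 0])

text \<open>The good parameters form an open set, as a union of strict inequalities between
  continuous functions. Its complement misses the proportion \<open>c\<close> of every ball of
  radius below h/2, whose diameter is below \<open>h\<close>.\<close>

lemma AE_good_approximation:
  fixes A :: "real^'n::finite^'m::finite" and Nm :: "real^'m \<Rightarrow> real" and Nn :: "real^'n \<Rightarrow> real"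
    and g :: "real^('m + 'n)^('m + 'n)"
  assumes Nm: "is_norm Nm" and Nn: "is_norm Nn"
    and r: "reachable (x_lattice A) (vinl p0) g W" and W: "dim W \<le> 1" and g: "det g = 1" and \<epsilon>: "0 < \<epsilon>"
  shows "AE t in lebesgue. \<exists>q\<in>int_vectors. N0 \<le> Nn q \<and>
     Nn q powr (real CARD('n) / real CARD('m)) * dist_to_int Nm (A *v q - (t *\<^sub>R p0 + \<eta>)) < \<epsilon>"
proof -
  define P where "P q k t \<longleftrightarrow> Nn q powr (real CARD('n) / real CARD('m)) * Nm (A *v q - (t *\<^sub>R p0 + \<eta>) - k) < \<epsilon>" for q k t
  define Good where "Good = (\<Union>q\<in>{q\<in>int_vectors. N0 \<le> Nn q}. \<Union>k\<in>int_vectors. {t. P q k t})"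
  have "open {t. P q k t}" for q k
    unfolding P_def
    by (intro open_Collect_less continuous_on_mult continuous_on_const is_norm_continuous_on[OF Nm] continuous_on_diff
        continuous_on_add continuous_on_scaleR continuous_on_id)
  then have op: "open Good" unfolding Good_def by (intro open_UN ballI)
  obtain L where L: "L \<noteq> 0" "W \<subseteq> span {L}" using dim_le_1_subset_span[OF W] by blast
  obtain c h where c: "0 < c" "0 < h" and G: "\<forall>a b N0. a < b \<longrightarrow> b - a \<le> h \<longrightarrow>
     (\<exists>G. G \<in> lmeasurable \<and> c * (b - a) \<le> measure lebesgue G \<and>
       G \<subseteq> {t\<in>{a..b}. \<exists>q\<in>int_vectors. \<exists>k\<in>int_vectors. N0 \<le> Nn q \<and>
          Nn q powr (real CARD('n) / real CARD('m)) * Nm (A *v q - (t *\<^sub>R p0 + \<eta>) - k) < \<epsilon>})"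
    by (rule approximations_have_positive_proportion[OF Nm Nn r L(2,1) g \<epsilon>])
  have "negligible (- Good)"
  proof (rule negligible_if_density_bounded)
    show "- Good \<in> sets lebesgue" using op by simp
    show "1 - c < 1" "0 < h / 2" using c by auto
    fix x d :: real assume d: "0 < d" "d < h / 2"
    have "x - d < x + d" "(x + d) - (x - d) \<le> h" using d by auto
    from G[rule_format, OF this, of N0] obtain G where G0: "G \<in> lmeasurable" "c * ((x + d) - (x - d)) \<le> measure lebesgue G"
      and G1: "G \<subseteq> {t\<in>{x - d..x + d}. \<exists>q\<in>int_vectors. \<exists>k\<in>int_vectors. N0 \<le> Nn q \<and> P q k t}"
      unfolding P_def by blast
    have G2: "{t\<in>{x - d..x + d}. \<exists>q\<in>int_vectors. \<exists>k\<in>int_vectors. N0 \<le> Nn q \<and> P q k t} \<subseteq> {x - d..x + d} \<inter> Good"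
      unfolding Good_def by blast
    have "G \<subseteq> {x - d..x + d} \<inter> Good" by (rule order_trans[OF G1 G2])
    note G = G0 this
    have "measure lebesgue (- Good \<inter> ball x d) \<le> measure lebesgue ({x - d..x + d} - G)"
    proof (rule measure_mono_fmeasurable)
      show "- Good \<inter> ball x d \<subseteq> {x - d..x + d} - G" using G(3) by (auto simp: dist_real_def)
      show "- Good \<inter> ball x d \<in> sets lebesgue" using op by (intro sets.Int) auto
      show "{x - d..x + d} - G \<in> lmeasurable" using G(1) by (intro fmeasurable_Diff) auto
    qed
    also have "\<dots> = measure lebesgue {x - d..x + d} - measure lebesgue G"
      using G by (intro measurable_measure_Diff) auto
    also have "\<dots> \<le> (1 - c) * (2 * d)" using G(2) d by (simp add: algebra_simps)
    also have "2 * d = measure lebesgue (ball x d)" using d by (simp add: ball_eq_greaterThanLessThan)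
    finally show "measure lebesgue (- Good \<inter> ball x d) \<le> (1 - c) * measure lebesgue (ball x d)" .
  qed
  then have "- Good \<in> null_sets lebesgue" by (simp add: negligible_iff_null_sets)
  then have "AE t in lebesgue. t \<notin> - Good" by (rule AE_not_in)
  then show ?thesis
  proof (rule AE_mp, intro AE_I2 impI)
    fix t assume "t \<notin> - Good"
    then obtain q k where q: "q \<in> int_vectors" "N0 \<le> Nn q" and k: "k \<in> int_vectors" and P: "P q k t"
      by (auto simp: Good_def)
    have "Nn q powr (real CARD('n) / real CARD('m)) * dist_to_int Nm (A *v q - (t *\<^sub>R p0 + \<eta>)) < \<epsilon>"
      using P mult_left_mono[OF dist_to_int_le[OF Nm k, of "A *v q - (t *\<^sub>R p0 + \<eta>)"], of "Nn q powr (real CARD('n) / real CARD('m))"]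
      unfolding P_def by simp
    then show "\<exists>q\<in>int_vectors. N0 \<le> Nn q \<and>
       Nn q powr (real CARD('n) / real CARD('m)) * dist_to_int Nm (A *v q - (t *\<^sub>R p0 + \<eta>)) < \<epsilon>"
      using q by blast
  qed
qed

text \<open>The filter expresses that integral \<open>q\<close> have norm tending to infinity. A
  positive lower limit would keep \<open>f\<close> above a positive real at all far integral points,
  against \<open>small\<close> for large \<open>k\<close>.\<close>

lemma Liminf_norm_filter_eq_0:
  fixes f :: "real^'n \<Rightarrow> real"
  assumes nonneg: "\<And>q. 0 \<le> f q"
    and small: "\<And>k::nat. \<exists>q\<in>int_vectors. real k \<le> N q \<and> f q < 1 / real (Suc k)"
  shows "Liminf (inf (filtercomap N at_top) (principal int_vectors)) (\<lambda>q. ereal (f q)) = 0"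
    (is "Liminf ?F _ = 0")
proof (rule antisym)
  show "0 \<le> Liminf ?F (\<lambda>q. ereal (f q))"
    using nonneg by (intro Liminf_bounded always_eventually) auto
  show "Liminf ?F (\<lambda>q. ereal (f q)) \<le> 0"
  proof (rule ccontr)
    assume "\<not> ?thesis"
    then obtain y where y: "0 < y" "y < Liminf ?F (\<lambda>q. ereal (f q))"
      using dense[of 0 "Liminf ?F (\<lambda>q. ereal (f q))"] by (auto simp: not_le)
    then have "eventually (\<lambda>q. y < ereal (f q)) ?F" using less_LiminfD by blast
    then obtain K where K: "\<And>q. K \<le> N q \<Longrightarrow> q \<in> int_vectors \<Longrightarrow> y < ereal (f q)"
      unfolding eventually_inf_principal eventually_filtercomap_at_top_linorder by blast
    obtain e where "0 < ereal e" "ereal e < y" using ereal_dense2[OF y(1)] by blast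
    then have e: "0 < e" "ereal e \<le> y" by auto
    obtain k :: nat where k: "max K (1 / e) \<le> real k" using real_arch_simple by blast
    obtain q where q: "q \<in> int_vectors" "real k \<le> N q" "f q < 1 / real (Suc k)" using small by blast
    have "1 / real (Suc k) \<le> e"
    proof -
      have "1 / e \<le> real (Suc k)" using k by simp
      then show ?thesis using e by (simp add: field_simps)
    qed
    then have "ereal (f q) \<le> ereal e" using q(3) by simp
    moreover have "y < ereal (f q)" using K q k by simp
    ultimately show False using e(2) by (meson leD order_trans)
  qed
qed

theorem theorem1p16:
  fixes A :: "real^'n^'m"
    and Nm :: "real^'m \<Rightarrow> real" and Nn :: "real^'n \<Rightarrow> real"
    and p0 \<eta> :: "real^'m"
  assumes "is_norm Nm" and "is_norm Nn"
    and "coprime CARD('m) CARD('n)"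
    and "\<exists>xs. accumulation_sequence (x_lattice A) xs \<and> length xs = CARD('m) + CARD('n)"
    and "p0 \<in> int_vectors" and "p0 \<noteq> 0"
  shows "AE t in lebesgue.
    Liminf (inf (filtercomap Nn at_top) (principal int_vectors))
      (\<lambda>q. ereal (Nn q powr (real CARD('n) / real CARD('m)) *
                  dist_to_int Nm (A *v q - (t *\<^sub>R p0 + \<eta>)))) = 0"
proof -
  obtain xs where xs: "accumulation_sequence (x_lattice A) xs" "length xs = CARD('m) + CARD('n)"
    using assms(4) by blast
  have card: "0 < CARD('m)" "0 < CARD('n)" by simp_all
  \<comment> \<open>\<open>Suc i\<close> is d - 1, the index of the last entry, so the remaining
    dimension is at most 1.\<close>
  define i where "i = CARD('m) + CARD('n) - 2"
  have i: "Suc i < CARD('m) + CARD('n)" "CARD('m) + CARD('n) - Suc i = 1"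
    using card unfolding i_def by linarith+
  define p where "p = (vinl p0 :: real^('m + 'n))"
  have p1: "p $ Inr j = 0" for j by (simp add: p_def vinl_def)
  have "vfst p = p0" by (simp add: p_def)
  moreover have "vfst (0 :: real^('m + 'n)) = 0" by (simp add: vfst_def vec_eq_iff)
  ultimately have p2: "p \<noteq> 0" using assms(6) by auto
  obtain g W where g: "det g = 1" and W: "dim W \<le> 1" and r: "reachable (x_lattice A) (vinl p0) g W"
    using accumulation_sequence_reachable[OF assms(3) xs(1) p1 p2, of i] i xs(2) unfolding p_def by auto
  \<comment> \<open>Countably many thresholds suffice, so the exceptional sets can be united
    afterwards.\<close>
  have "AE t in lebesgue. \<exists>q\<in>int_vectors. real k \<le> Nn q \<and>
     Nn q powr (real CARD('n) / real CARD('m)) * dist_to_int Nm (A *v q - (t *\<^sub>R p0 + \<eta>)) < 1 / real (Suc k)" for k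
    by (rule AE_good_approximation[OF assms(1,2) r W g]) simp
  then have "AE t in lebesgue. \<forall>k. \<exists>q\<in>int_vectors. real k \<le> Nn q \<and>
     Nn q powr (real CARD('n) / real CARD('m)) * dist_to_int Nm (A *v q - (t *\<^sub>R p0 + \<eta>)) < 1 / real (Suc k)"
    by (simp add: AE_all_countable)
  then show ?thesis
  proof (rule AE_mp, intro AE_I2 impI)
    fix t
    assume small: "\<forall>k. \<exists>q\<in>int_vectors. real k \<le> Nn q \<and>
       Nn q powr (real CARD('n) / real CARD('m)) * dist_to_int Nm (A *v q - (t *\<^sub>R p0 + \<eta>)) < 1 / real (Suc k)"
    show "Liminf (inf (filtercomap Nn at_top) (principal int_vectors))
      (\<lambda>q. ereal (Nn q powr (real CARD('n) / real CARD('m)) *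
                  dist_to_int Nm (A *v q - (t *\<^sub>R p0 + \<eta>)))) = 0"
      by (rule Liminf_norm_filter_eq_0) (use small dist_to_int_nonneg[OF assms(1)] in auto)
  qed
qed

end
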